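(* Let $\mu,\nu\in\mathcal P_1(\mathbb R)$ be such that $\mu\le_{cx}\nu$, $\mu\neq\nu$, and on each interval $(F_\mu(x-),F_\mu(x)]$, where $x\in\mathbb R$, the sign of $u\mapsto F_\mu^{-1}(u)-F_\nu^{-1}(u)$ is constant (i.e. this function is either nonnegative on the whole interval or nonpositive on the whole interval). Then for all $Q\in\mathcal Q$, the martingale coupling $M^Q(dx,dy)=\int_0^1\delta_{F_\mu^{-1}(u)}(dx)\,\widetilde m^Q_u(dy)\,du$ is a martingale rearrangement coupling of the Hoeffding-Fréchet coupling $\pi^{HF}$ between $\mu$ and $\nu$, that is $$\forall Q\in\mathcal Q,\quad\mathcal{AW}_1(\pi^{HF},M^Q)=\inf_{M\in\Pi^{\mathrm M}(\mu,\nu)}\mathcal{AW}_1(\pi^{HF},M).$$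
   Context: **General notation.** $\mathcal P_1(\mathbb R)$ is the set of probability measures on $\mathbb R$ with finite first moment. $\Pi(\mu,\nu)$ is the set of couplings of $\mu$ and $\nu$; $(\pi_x)_{x\in\mathbb R}$ denotes the disintegration $\pi(dx,dy)=\mu(dx)\,\pi_x(dy)$ of $\pi\in\Pi(\mu,\nu)$. $\Pi^{\mathrm M}(\mu,\nu)$ is the set of $M\in\Pi(\mu,\nu)$ with $\int_{\mathbb R}y\,M_x(dy)=x$ for $\mu$-a.e. $x$. $\mu\le_{cx}\nu$ (convex order) means $\int f\,d\mu\le\int f\,d\nu$ for all convex $f:\mathbb R\to\mathbb R$. $F_\eta(x)=\eta((-\infty,x])$, $F_\eta(x-)$ is its left limit, and $F_\eta^{-1}(u)=\inf\{x\in\mathbb R: F_\eta(x)\ge u\}$ for $u\in(0,1)$ (intervals $(F_\mu(x-),F_\mu(x)]$ are understood within $(0,1)$). $\pi^{HF}$ is the image of the Lebesgue measure on $(0,1)$ by $u\mapsto(F_\mu^{-1}(u),F_\nu^{-1}(u))$. $\mathcal W_1$ is the Wasserstein distance of order 1, and for $\pi,\pi'\in\Pi(\mu,\nu)$, $$\mathcal{AW}_1(\pi,\pi')=\inf_{\chi\in\Pi(\mu,\mu)}\int_{\mathbb R\times\mathbb R}\left(|x-x'|+\mathcal W_1(\pi_x,\pi'_{x'})\right)\chi(dx,dx').$$ $M\in\Pi^{\mathrm M}(\mu,\nu)$ is a martingale rearrangement coupling of $\pi\in\Pi(\mu,\nu)$ if it minimises $\mathcal{AW}_1(\pi,\cdot)$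 over $\Pi^{\mathrm M}(\mu,\nu)$. **The family $\mathcal Q$ and the kernels $\widetilde m^Q$.** For $u\in[0,1]$ let $\Psi_+(u)=\int_0^u(F_\mu^{-1}-F_\nu^{-1})^+(v)\,dv$ and $\Psi_-(u)=\int_0^u(F_\mu^{-1}-F_\nu^{-1})^-(v)\,dv$ (positive and negative parts); $\Psi_+(1)=\Psi_-(1)>0$. $\mathcal Q$ is the set of probability measures $Q$ on $(0,1)^2$ with first marginal $\frac1{\Psi_+(1)}d\Psi_+$, second marginal $\frac1{\Psi_+(1)}d\Psi_-$ and such that $u<v$ for $Q(du,dv)$-almost every $(u,v)$. As $d\Psi_+$ and $d\Psi_-$ are concentrated on disjoint Borel sets, for each $Q\in\mathcal Q$ there is a probability kernel $(\pi^Q_u)_{u\in(0,1)}$ on $(0,1)$ such that $$Q(du,dv)=\tfrac1{\Psi_+(1)}d\Psi_+(u)\,\pi^Q_u(dv)=\tfrac1{\Psi_+(1)}d\Psi_-(v)\,\pi^Q_v(du).$$ $(\widetilde m^Q_u)_{u\in(0,1)}$ is a probability kernel on $\mathbb R$ such that for $du$-almost all $u\in(0,1)$ with $F_\mu^{-1}(u)\neq F_\nu^{-1}(u)$, $$\widetilde m^Q_u(dy)=\int_{v\in(0,1)}\left(\frac{F_\mu^{-1}(u)-F_\nu^{-1}(u)}{F_\nu^{-1}(v)-F_\nu^{-1}(u)}\delta_{F_\nu^{-1}(v)}(dy)+\frac{F_\nu^{-1}(v)-F_\mu^{-1}(u)}{F_\nu^{-1}(v)-F_\nu^{-1}(u)}\delta_{F_\nu^{-1}(u)}(dy)\right)\pi^Q_u(dv),$$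 and $\widetilde m^Q_u=\delta_{F_\nu^{-1}(u)}$ for all $u$ with $F_\mu^{-1}(u)=F_\nu^{-1}(u)$. It is known that $M^Q\in\Pi^{\mathrm M}(\mu,\nu)$. *)

theory Defs
  imports "HOL-Probability.Probability"
begin

definition P1 :: "real measure set" where
  "P1 = {\<mu>. real_distribution \<mu> \<and> integrable \<mu> (\<lambda>x. x)}"

text \<open>For measures in \<open>P1\<close> a convex function is bounded below by an integrable affine function, so both
  integrals exist in the extended sense with values in \<open>(-\<infinity>, \<infinity>]\<close>. The inequality is trivial if
  the right-hand integral is infinite; otherwise it says that the left-hand one is finite too and
  not larger. Bochner integrals alone would assign the value 0 to the infinite case.\<close>

definition convex_order_le :: "real measure \<Rightarrow> real measure \<Rightarrow> bool" where
  "convex_order_le \<mu> \<nu> \<longleftrightarrow>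
    (\<forall>f. convex_on UNIV f \<longrightarrow> integrable \<nu> f \<longrightarrow>
       integrable \<mu> f \<and> (\<integral>x. f x \<partial>\<mu>) \<le> (\<integral>x. f x \<partial>\<nu>))"

definition quantile :: "real measure \<Rightarrow> real \<Rightarrow> real" where
  "quantile \<eta> u = Inf {x. cdf \<eta> x \<ge> u}"

definition couplings :: "'a measure \<Rightarrow> 'b measure \<Rightarrow> ('a \<times> 'b) measure set" where
  "couplings \<mu> \<nu> =
    {\<pi>. prob_space \<pi> \<and> sets \<pi> = sets (\<mu> \<Otimes>\<^sub>M \<nu>) \<and> distr \<pi> \<mu> fst = \<mu> \<and> distr \<pi> \<nu> snd = \<nu>}"

text \<open>\<open>\<pi>(dx,dy) = \<mu>(dx) \<kappa>\<^sub>x(dy)\<close> with a probability kernel \<open>\<kappa>\<close> from the space of \<open>\<mu>\<close> to \<open>Y\<close>\<close>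

definition disintegrates ::
    "'b measure \<Rightarrow> 'a measure \<Rightarrow> ('a \<times> 'b) measure \<Rightarrow> ('a \<Rightarrow> 'b measure) \<Rightarrow> bool" where
  "disintegrates Y \<mu> \<pi> \<kappa> \<longleftrightarrow>
    \<kappa> \<in> \<mu> \<rightarrow>\<^sub>M prob_algebra Y \<and>
    (\<forall>C\<in>sets (\<mu> \<Otimes>\<^sub>M Y). emeasure \<pi> C = (\<integral>\<^sup>+ x. emeasure (\<kappa> x) (Pair x -` C) \<partial>\<mu>))"

text \<open>A version of the disintegration with respect to the first marginal \<open>\<mu>\<close>. It exists for all
  Borel couplings on the real line and is unique up to \<open>\<mu>\<close>-null sets, so that nothing below depends on
  the choice.\<close>

definition disintegration ::
    "real measure \<Rightarrow> (real \<times> real) measure \<Rightarrow> real \<Rightarrow> real measure" where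
  "disintegration \<mu> \<pi> = (SOME \<kappa>. disintegrates borel \<mu> \<pi> \<kappa>)"

definition martingale_couplings ::
    "real measure \<Rightarrow> real measure \<Rightarrow> (real \<times> real) measure set" where
  "martingale_couplings \<mu> \<nu> =
    {M \<in> couplings \<mu> \<nu>. AE x in \<mu>. (\<integral>y. y \<partial>(disintegration \<mu> M x)) = x}"

definition wasserstein1 :: "real measure \<Rightarrow> real measure \<Rightarrow> ennreal" where
  "wasserstein1 \<mu> \<nu> = (INF \<pi>\<in>couplings \<mu> \<nu>. \<integral>\<^sup>+ (x, y). ennreal \<bar>x - y\<bar> \<partial>\<pi>)"

definition adapted_wasserstein1 ::
    "real measure \<Rightarrow> (real \<times> real) measure \<Rightarrow> (real \<times> real) measure \<Rightarrow> ennreal" where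
  "adapted_wasserstein1 \<mu> \<pi> \<pi>' =
    (INF \<gamma>\<in>couplings \<mu> \<mu>. \<integral>\<^sup>+ (x, x').
       ennreal \<bar>x - x'\<bar> + wasserstein1 (disintegration \<mu> \<pi> x) (disintegration \<mu> \<pi>' x') \<partial>\<gamma>)"

definition martingale_rearrangement_coupling ::
    "real measure \<Rightarrow> real measure \<Rightarrow> (real \<times> real) measure \<Rightarrow> (real \<times> real) measure \<Rightarrow> bool" where
  "martingale_rearrangement_coupling \<mu> \<nu> \<pi> M \<longleftrightarrow>
    M \<in> martingale_couplings \<mu> \<nu> \<and>
    adapted_wasserstein1 \<mu> \<pi> M =
      (INF M'\<in>martingale_couplings \<mu> \<nu>. adapted_wasserstein1 \<mu> \<pi> M')"

abbreviation unit_interval :: "real measure" where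
  "unit_interval \<equiv> restrict_space lborel {0<..<1}"

definition hoeffding_frechet :: "real measure \<Rightarrow> real measure \<Rightarrow> (real \<times> real) measure" where
  "hoeffding_frechet \<mu> \<nu> =
    distr unit_interval (borel \<Otimes>\<^sub>M borel) (\<lambda>u. (quantile \<mu> u, quantile \<nu> u))"

text \<open>The functions \<open>\<Psi>\<^sub>+\<close> and \<open>\<Psi>\<^sub>-\<close>, extended to the real line by constants outside \<open>[0,1]\<close> as needed for
  the Lebesgue-Stieltjes measure \<open>interval_measure\<close>.\<close>

definition Psi_plus :: "real measure \<Rightarrow> real measure \<Rightarrow> real \<Rightarrow> real" where
  "Psi_plus \<mu> \<nu> u = (LBINT v:{0<..<1} \<inter> {..u}. max 0 (quantile \<mu> v - quantile \<nu> v))"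

definition Psi_minus :: "real measure \<Rightarrow> real measure \<Rightarrow> real \<Rightarrow> real" where
  "Psi_minus \<mu> \<nu> u = (LBINT v:{0<..<1} \<inter> {..u}. max 0 (- (quantile \<mu> v - quantile \<nu> v)))"

definition normalized_dPsi_plus :: "real measure \<Rightarrow> real measure \<Rightarrow> real measure" where
  "normalized_dPsi_plus \<mu> \<nu> =
    scale_measure (ennreal (1 / Psi_plus \<mu> \<nu> 1))
      (restrict_space (interval_measure (Psi_plus \<mu> \<nu>)) {0<..<1})"

definition normalized_dPsi_minus :: "real measure \<Rightarrow> real measure \<Rightarrow> real measure" where
  "normalized_dPsi_minus \<mu> \<nu> =
    scale_measure (ennreal (1 / Psi_plus \<mu> \<nu> 1))
      (restrict_space (interval_measure (Psi_minus \<mu> \<nu>)) {0<..<1})"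

definition Q_set :: "real measure \<Rightarrow> real measure \<Rightarrow> (real \<times> real) measure set" where
  "Q_set \<mu> \<nu> =
    {Q \<in> couplings (normalized_dPsi_plus \<mu> \<nu>) (normalized_dPsi_minus \<mu> \<nu>). AE (u, v) in Q. u < v}"

text \<open>\<open>\<kappa>\<close> is a version of the kernel \<open>\<pi>\<^sup>Q\<close>: a single kernel which disintegrates \<open>Q\<close> with respect to the first
  marginal and, after exchanging the coordinates, with respect to the second one.\<close>

definition Q_kernel ::
    "real measure \<Rightarrow> real measure \<Rightarrow> (real \<times> real) measure \<Rightarrow> (real \<Rightarrow> real measure) \<Rightarrow> bool" where
  "Q_kernel \<mu> \<nu> Q \<kappa> \<longleftrightarrow>
    disintegrates unit_interval (normalized_dPsi_plus \<mu> \<nu>) Q \<kappa> \<and>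
    disintegrates unit_interval (normalized_dPsi_minus \<mu> \<nu>)
      (distr Q (unit_interval \<Otimes>\<^sub>M unit_interval) (\<lambda>(u, v). (v, u))) \<kappa>"

text \<open>\<open>m\<close> is a version of the kernel obtained from \<open>\<kappa> = \<pi>\<^sup>Q\<close>. For almost every \<open>u\<close> the two weights lie in
  \<open>[0,1]\<close> and have a nonzero denominator, for \<open>\<kappa>\<^sub>u\<close>-almost every \<open>v\<close>.\<close>

definition martingale_kernel ::
    "real measure \<Rightarrow> real measure \<Rightarrow> (real \<Rightarrow> real measure) \<Rightarrow> (real \<Rightarrow> real measure) \<Rightarrow> bool" where
  "martingale_kernel \<mu> \<nu> \<kappa> m \<longleftrightarrow>
    m \<in> unit_interval \<rightarrow>\<^sub>M prob_algebra borel \<and>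
    (AE u in unit_interval. quantile \<mu> u \<noteq> quantile \<nu> u \<longrightarrow>
      (\<forall>B\<in>sets borel. measure (m u) B =
        (\<integral>v. (quantile \<mu> u - quantile \<nu> u) / (quantile \<nu> v - quantile \<nu> u) * indicator B (quantile \<nu> v)
            + (quantile \<nu> v - quantile \<mu> u) / (quantile \<nu> v - quantile \<nu> u) * indicator B (quantile \<nu> u)
          \<partial>\<kappa> u))) \<and>
    (\<forall>u\<in>{0<..<1}. quantile \<mu> u = quantile \<nu> u \<longrightarrow> m u = return borel (quantile \<nu> u))"

definition M_coupling :: "real measure \<Rightarrow> (real \<Rightarrow> real measure) \<Rightarrow> (real \<times> real) measure" where
  "M_coupling \<mu> m = unit_interval \<bind> (\<lambda>u. return borel (quantile \<mu> u) \<Otimes>\<^sub>M m u)"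

end

theory Submission
  imports Defs
begin

text \<open>
  Write \<open>\<pi>\<close> for the Hoeffding-Frechet coupling and \<open>b(x)\<close> for the barycentre of \<open>\<pi>\<^sub>x\<close>. The proof identifies the minimal
  value of the adapted distance as \<open>\<integral> \<bar>x - b(x)\<bar> \<mu>(dx)\<close>.

  Every martingale coupling is at least that far from \<open>\<pi>\<close>: the distance between two laws dominates the distance between their
  means, the mean of \<open>M\<^sub>x\<^sub>'\<close> is \<open>x'\<close>, and the triangle inequality removes \<open>x'\<close>
  (lemma \<open>adapted_wasserstein1_ge_barycentre_distance\<close>).

  The coupling \<open>M\<^sup>Q\<close> attains the bound. Let \<open>U\<^sub>x\<close> be the conditional law of a uniform parameter \<open>u\<close> given \<open>F\<^sub>\<mu>\<^sup>-\<^sup>1(u) = x\<close>. Then \<open>\<pi>\<^sub>x\<close> is the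
  image of \<open>U\<^sub>x\<close> under \<open>F\<^sub>\<nu>\<^sup>-\<^sup>1\<close>, and \<open>M\<^sup>Q\<^sub>x\<close> is the mixture of the laws \<open>m\<^sub>u\<close> under \<open>U\<^sub>x\<close>. The law \<open>m\<^sub>u\<close> has mean \<open>F\<^sub>\<mu>\<^sup>-\<^sup>1(u)\<close> and lies
  on one side of \<open>F\<^sub>\<nu>\<^sup>-\<^sup>1(u)\<close>, so that moving the point mass at \<open>F\<^sub>\<nu>\<^sup>-\<^sup>1(u)\<close> to \<open>m\<^sub>u\<close> costs exactly \<open>\<bar>F\<^sub>\<mu>\<^sup>-\<^sup>1(u) - F\<^sub>\<nu>\<^sup>-\<^sup>1(u)\<bar>\<close>
  (\<open>martingale_mixture_cost\<close>). Doing this for all \<open>u\<close> in the fibre bounds \<open>W\<^sub>1(\<pi>\<^sub>x, M\<^sup>Q\<^sub>x)\<close> by the average of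
  \<open>\<bar>x - F\<^sub>\<nu>\<^sup>-\<^sup>1(u)\<bar>\<close> under \<open>U\<^sub>x\<close>. The sign hypothesis says that \<open>x - F\<^sub>\<nu>\<^sup>-\<^sup>1(u)\<close> keeps its sign on the fibre
  (\<open>AE_fibre_constant_sign\<close>), so that the average of its absolute value is the absolute value \<open>\<bar>x - b(x)\<bar>\<close> of its average
  (\<open>adapted_wasserstein1_le_from_fibres\<close>).

  It remains to see that \<open>M\<^sup>Q\<close> is a martingale coupling of \<open>\<mu>\<close> and \<open>\<nu>\<close>. The martingale property is the statement on the means
  of \<open>m\<^sub>u\<close>. For the second marginal, \<open>m\<close> exchanges mass between \<open>F\<^sub>\<nu>\<^sup>-\<^sup>1(u)\<close> and \<open>F\<^sub>\<nu>\<^sup>-\<^sup>1(v)\<close> at a rate that is symmetric in \<open>u\<close> and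
  \<open>v\<close>, because the same kernel disintegrates \<open>Q\<close> with respect to either marginal; gains and losses therefore cancel
  (\<open>nn_integral_emeasure_martingale_kernel\<close>).

  All this uses the existence and the almost sure uniqueness of disintegrations of probability measures on the plane, which
  come first.
\<close>

section \<open>Disintegration of measures on the plane\<close>

text \<open>On the set where \<open>g < f\<close> the two integrals would otherwise compare strictly in the wrong direction; finiteness of
the integral of \<open>g\<close> is what makes the strict comparison legitimate.\<close>

lemma AE_le_if_set_nn_integral_le:
  fixes f g :: "'a \<Rightarrow> ennreal"
  assumes [measurable]: "f \<in> borel_measurable M" "g \<in> borel_measurable M"
    and fin: "(\<integral>\<^sup>+x. g x \<partial>M) < \<infinity>"
    and le: "\<And>A. A \<in> sets M \<Longrightarrow> (\<integral>\<^sup>+x\<in>A. f x \<partial>M) \<le> (\<integral>\<^sup>+x\<in>A. g x \<partial>M)"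
  shows "AE x in M. f x \<le> g x"
proof -
  define A where "A = {x\<in>space M. g x < f x}"
  have [measurable]: "A \<in> sets M" unfolding A_def by measurable
  have "(\<integral>\<^sup>+x\<in>A. g x \<partial>M) \<le> (\<integral>\<^sup>+x. g x \<partial>M)"
    by (intro nn_integral_mono) (auto split: split_indicator)
  with fin have fin': "(\<integral>\<^sup>+x\<in>A. g x \<partial>M) \<noteq> \<infinity>" by auto
  have ord: "AE x in M. g x * indicator A x \<le> f x * indicator A x"
    by (auto simp: A_def split: split_indicator)
  have "AE x in M. f x * indicator A x \<le> g x * indicator A x"
  proof (rule ccontr)
    assume "\<not> ?thesis"
    then have "(\<integral>\<^sup>+x\<in>A. g x \<partial>M) < (\<integral>\<^sup>+x\<in>A. f x \<partial>M)"
      by (intro nn_integral_less fin' ord) auto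
    with leD[OF le[of A]] show False by simp
  qed
  then show ?thesis
    using AE_space by eventually_elim (auto simp: A_def not_less split: split_indicator_asm)
qed

text \<open>Conditional distribution functions are only determined almost everywhere, so that only countably many of their values
can be controlled at once. Right limits along the rationals turn such a countable family into a genuine
distribution function.\<close>

lemma cdf_from_rationals:
  fixes h :: "real \<Rightarrow> real"
  assumes mono: "\<And>q r. q \<in> \<rat> \<Longrightarrow> r \<in> \<rat> \<Longrightarrow> q \<le> r \<Longrightarrow> h q \<le> h r"
    and bounds: "\<And>q. q \<in> \<rat> \<Longrightarrow> 0 \<le> h q \<and> h q \<le> 1"
    and top: "\<And>e. 0 < e \<Longrightarrow> \<exists>n::nat. 1 - e < h (real n)"
    and bot: "\<And>e. 0 < e \<Longrightarrow> \<exists>n::nat. h (- real n) < e"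
  defines "F \<equiv> \<lambda>y. (INF q\<in>{q\<in>\<rat>. y < q}. h q)"
  shows "\<And>x y. x \<le> y \<Longrightarrow> F x \<le> F y" "\<And>a. continuous (at_right a) F"
    "(F \<longlongrightarrow> 0) at_bot" "(F \<longlongrightarrow> 1) at_top"
proof -
  have ne: "{q\<in>\<rat>. y < q} \<noteq> {}" for y :: real
    using Rats_dense_in_real[of y "y + 1"] by auto
  have bdd: "bdd_below (h ` {q\<in>\<rat>. y < q})" for y
    using bounds by (auto intro!: bdd_belowI[of _ 0])
  have upper: "F y \<le> h q" if "q \<in> \<rat>" "y < q" for y q
    unfolding F_def using that by (intro cINF_lower bdd) auto
  have lower: "c \<le> F y" if "\<And>q. q \<in> \<rat> \<Longrightarrow> y < q \<Longrightarrow> c \<le> h q" for y c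
    unfolding F_def using that by (intro cINF_greatest ne) auto
  show mono_F: "\<And>x y. x \<le> y \<Longrightarrow> F x \<le> F y"
    by (intro lower upper) auto
  have F0: "0 \<le> F y" for y using bounds by (intro lower) auto
  have F1: "F y \<le> 1" for y
    using Rats_dense_in_real[of y "y + 1"] upper[of _ y] bounds by force
  show "continuous (at_right a) F" for a
    unfolding continuous_within
  proof (rule order_tendstoI)
    fix c assume "c < F a"
    then have "c < F y" if "a < y" for y using mono_F[of a y] that by auto
    then show "\<forall>\<^sub>F y in at_right a. c < F y"
      by (auto simp: eventually_at_right_field intro!: exI[of _ "a + 1"])
  next
    fix c assume "F a < c"
    then obtain q where q: "q \<in> \<rat>" "a < q" "h q < c"
      using lower[of a c] by (force simp: not_le)
    then have "F y < c" if "y < q" for y using upper[of q y] that by auto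
    with q show "\<forall>\<^sub>F y in at_right a. F y < c"
      by (auto simp: eventually_at_right_field)
  qed
  show "(F \<longlongrightarrow> 0) at_bot"
  proof (rule order_tendstoI)
    fix c :: real assume "c < 0"
    then show "\<forall>\<^sub>F y in at_bot. c < F y" by (intro always_eventually allI less_le_trans[OF _ F0])
  next
    fix c :: real assume "0 < c"
    then obtain n :: nat where "h (- real n) < c" using bot by blast
    then have "F y < c" if "y < - real n" for y using upper[of "- real n" y] that by auto
    then show "\<forall>\<^sub>F y in at_bot. F y < c"
      by (auto simp: eventually_at_bot_dense)
  qed
  show "(F \<longlongrightarrow> 1) at_top"
  proof (rule order_tendstoI)
    fix c :: real assume "1 < c"
    then show "\<forall>\<^sub>F y in at_top. F y < c" by (intro always_eventually allI le_less_trans[OF F1])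
  next
    fix c :: real assume "c < 1"
    then obtain n :: nat where n: "c < h (real n)" using top[of "1 - c"] by auto
    have "c < F y" if "real n < y" for y
      using n by (rule less_le_trans) (use mono that in \<open>auto intro!: lower\<close>)
    then show "\<forall>\<^sub>F y in at_top. c < F y"
      by (auto simp: eventually_at_top_dense)
  qed
qed

lemma nn_integral_disintegrates:
  assumes \<kappa>: "disintegrates Y \<mu> \<pi> \<kappa>" and sets: "sets \<pi> = sets (\<mu> \<Otimes>\<^sub>M Y)" and ne: "space \<mu> \<noteq> {}"
    and f[measurable]: "f \<in> borel_measurable (\<mu> \<Otimes>\<^sub>M Y)"
  shows "(\<integral>\<^sup>+z. f z \<partial>\<pi>) = (\<integral>\<^sup>+x. \<integral>\<^sup>+y. f (x, y) \<partial>\<kappa> x \<partial>\<mu>)"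
proof -
  have K[measurable]: "\<kappa> \<in> \<mu> \<rightarrow>\<^sub>M prob_algebra Y" using \<kappa> by (simp add: disintegrates_def)
  \<comment> \<open>Attaching the point \<open>x\<close> to \<open>\<kappa> x\<close> exhibits \<open>\<pi>\<close> as a monadic composition, for which the formula is known.\<close>
  define K2 where "K2 = (\<lambda>x. distr (\<kappa> x) (\<mu> \<Otimes>\<^sub>M Y) (Pair x))"
  have K2: "K2 \<in> \<mu> \<rightarrow>\<^sub>M subprob_algebra (\<mu> \<Otimes>\<^sub>M Y)"
    unfolding K2_def by (intro measurable_prob_algebraD) measurable
  have S: "sets (\<kappa> x) = sets Y" if "x \<in> space \<mu>" for x
    using measurable_space[OF K that] by (auto simp: space_prob_algebra)
  have "\<pi> = \<mu> \<bind> K2"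
  proof (rule measure_eqI)
    show "sets \<pi> = sets (\<mu> \<bind> K2)" using sets_bind[OF sets_kernel[OF K2] ne] sets by auto
    fix C assume "C \<in> sets \<pi>"
    then have C[measurable]: "C \<in> sets (\<mu> \<Otimes>\<^sub>M Y)" using sets by auto
    have "emeasure (\<mu> \<bind> K2) C = (\<integral>\<^sup>+x. emeasure (K2 x) C \<partial>\<mu>)"
      by (rule emeasure_bind[OF ne K2 C])
    also have "\<dots> = (\<integral>\<^sup>+ x. emeasure (\<kappa> x) (Pair x -` C) \<partial>\<mu>)"
    proof (rule nn_integral_cong)
      fix x assume x: "x \<in> space \<mu>"
      then have "Pair x -` C \<inter> space (\<kappa> x) = Pair x -` C"
        using sets.sets_into_space[OF C] sets_eq_imp_space_eq[OF S[OF x]] by (auto simp: space_pair_measure)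
      then show "emeasure (K2 x) C = emeasure (\<kappa> x) (Pair x -` C)"
        unfolding K2_def using x S[OF x] by (subst emeasure_distr) (auto cong: measurable_cong_sets)
    qed
    finally show "emeasure \<pi> C = emeasure (\<mu> \<bind> K2) C"
      using \<kappa> C by (auto simp: disintegrates_def)
  qed
  then have "(\<integral>\<^sup>+z. f z \<partial>\<pi>) = (\<integral>\<^sup>+x. \<integral>\<^sup>+z. f z \<partial>K2 x \<partial>\<mu>)"
    using nn_integral_bind[OF f K2] by simp
  also have "\<dots> = (\<integral>\<^sup>+x. \<integral>\<^sup>+y. f (x, y) \<partial>\<kappa> x \<partial>\<mu>)"
    unfolding K2_def using S
    by (intro nn_integral_cong nn_integral_distr) (auto cong: measurable_cong_sets)
  finally show ?thesis .
qed

text \<open>The exceptional set is first enlarged to a measurable null set, so that \<open>P\<close> may be an arbitrary predicate.\<close>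

lemma AE_disintegrates:
  assumes \<kappa>: "disintegrates Y \<mu> \<pi> \<kappa>" and sets: "sets \<pi> = sets (\<mu> \<Otimes>\<^sub>M Y)" and ne: "space \<mu> \<noteq> {}"
    and P: "AE (x, y) in \<pi>. P x y"
  shows "AE x in \<mu>. AE y in \<kappa> x. P x y"
proof -
  have K[measurable]: "\<kappa> \<in> \<mu> \<rightarrow>\<^sub>M prob_algebra Y" using \<kappa> by (simp add: disintegrates_def)
  have K': "\<kappa> \<in> \<mu> \<rightarrow>\<^sub>M subprob_algebra Y" by (rule measurable_prob_algebraD[OF K])
  obtain N where N: "{z\<in>space \<pi>. \<not> (case z of (x, y) \<Rightarrow> P x y)} \<subseteq> N" "emeasure \<pi> N = 0" "N \<in> sets \<pi>"
    using AE_E[OF P] by metis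
  have NY[measurable]: "N \<in> sets (\<mu> \<Otimes>\<^sub>M Y)" using N sets by simp
  have sp: "space \<pi> = space \<mu> \<times> space Y" using sets_eq_imp_space_eq[OF sets] by (simp add: space_pair_measure)
  have "(\<integral>\<^sup>+x. emeasure (\<kappa> x) (Pair x -` N) \<partial>\<mu>) = 0" using \<kappa> N NY by (auto simp: disintegrates_def)
  moreover have "(\<lambda>x. emeasure (\<kappa> x) (Pair x -` N)) \<in> borel_measurable \<mu>"
  proof (rule emeasure_measurable_subprob_algebra2[OF _ K'])
    have "(SIGMA x:space \<mu>. Pair x -` N) = N"
      using sets.sets_into_space[OF NY] by (auto simp: space_pair_measure)
    with NY show "(SIGMA x:space \<mu>. Pair x -` N) \<in> sets (\<mu> \<Otimes>\<^sub>M Y)" by simp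
  qed
  ultimately have "AE x in \<mu>. emeasure (\<kappa> x) (Pair x -` N) = 0"
    by (simp add: nn_integral_0_iff_AE)
  then show ?thesis
    using AE_space
  proof eventually_elim
    case (elim x)
    have S: "sets (\<kappa> x) = sets Y" using measurable_space[OF K elim(2)] by (auto simp: space_prob_algebra)
    from elim show ?case
      using N(1) sp sets_eq_imp_space_eq[OF S] S
      by (intro AE_I[where N="Pair x -` N"]) auto
  qed
qed

text \<open>Two kernels with the same integrals have the same distribution functions at all rationals outside a single null
set, and right continuity extends this to all reals.\<close>

lemma disintegrates_unique:
  fixes \<kappa> \<kappa>' :: "'a \<Rightarrow> real measure"
  assumes \<mu>: "sigma_finite_measure \<mu>"
    and 1: "disintegrates borel \<mu> \<pi> \<kappa>" and 2: "disintegrates borel \<mu> \<pi> \<kappa>'"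
  shows "AE x in \<mu>. \<kappa> x = \<kappa>' x"
proof -
  interpret sigma_finite_measure \<mu> by fact
  have K[measurable]: "\<kappa> \<in> \<mu> \<rightarrow>\<^sub>M prob_algebra borel" "\<kappa>' \<in> \<mu> \<rightarrow>\<^sub>M prob_algebra borel"
    using 1 2 by (auto simp: disintegrates_def)
  have cdfs: "AE x in \<mu>. emeasure (\<kappa> x) {..q} = emeasure (\<kappa>' x) {..q}" for q
  proof (rule density_unique)
    have meas: "(\<lambda>x. emeasure (\<eta> x) {..q}) \<in> borel_measurable \<mu>" if "\<eta> \<in> \<mu> \<rightarrow>\<^sub>M prob_algebra borel" for \<eta>
      by (rule measurable_emeasure_kernel[OF measurable_prob_algebraD[OF that]]) simp
    show m: "(\<lambda>x. emeasure (\<kappa> x) {..q}) \<in> borel_measurable \<mu>" "(\<lambda>x. emeasure (\<kappa>' x) {..q}) \<in> borel_measurable \<mu>"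
      using meas K by auto
    show "density \<mu> (\<lambda>x. emeasure (\<kappa> x) {..q}) = density \<mu> (\<lambda>x. emeasure (\<kappa>' x) {..q})"
    proof (rule measure_eqI)
      fix A assume "A \<in> sets (density \<mu> (\<lambda>x. emeasure (\<kappa> x) {..q}))"
      then have A: "A \<in> sets \<mu>" by simp
      have *: "emeasure (density \<mu> (\<lambda>x. emeasure (\<eta> x) {..q})) A = emeasure \<pi> (A \<times> {..q})"
        if "disintegrates borel \<mu> \<pi> \<eta>" for \<eta>
      proof -
        have "emeasure (density \<mu> (\<lambda>x. emeasure (\<eta> x) {..q})) A = (\<integral>\<^sup>+x\<in>A. emeasure (\<eta> x) {..q} \<partial>\<mu>)"
          using A meas that by (intro emeasure_density) (auto simp: disintegrates_def)
        also have "\<dots> = (\<integral>\<^sup>+x. emeasure (\<eta> x) (Pair x -` (A \<times> {..q})) \<partial>\<mu>)"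
          by (intro nn_integral_cong) (auto split: split_indicator)
        also have "\<dots> = emeasure \<pi> (A \<times> {..q})"
          using that A by (auto simp: disintegrates_def)
        finally show ?thesis .
      qed
      show "emeasure (density \<mu> (\<lambda>x. emeasure (\<kappa> x) {..q})) A = emeasure (density \<mu> (\<lambda>x. emeasure (\<kappa>' x) {..q})) A"
        using *[OF 1] *[OF 2] by simp
    qed simp
  qed
  have "AE x in \<mu>. \<forall>q\<in>\<rat>. emeasure (\<kappa> x) {..q} = emeasure (\<kappa>' x) {..q}"
    using cdfs by (subst AE_ball_countable) (auto simp: countable_rat)
  then show ?thesis
    using AE_space
  proof eventually_elim
    case (elim x)
    from measurable_space[OF K(1) elim(2)] measurable_space[OF K(2) elim(2)]
    have sp: "prob_space (\<kappa> x)" "sets (\<kappa> x) = sets borel" "prob_space (\<kappa>' x)" "sets (\<kappa>' x) = sets borel"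
      by (auto simp: space_prob_algebra)
    then have rd: "real_distribution (\<kappa> x)" "real_distribution (\<kappa>' x)"
      by (auto simp: real_distribution_def real_distribution_axioms_def sets_eq_imp_space_eq)
    interpret k: real_distribution "\<kappa> x" by fact
    interpret k': real_distribution "\<kappa>' x" by fact
    have *: "cdf (\<kappa> x) q = cdf (\<kappa>' x) q" if "q \<in> \<rat>" for q
      using elim(1) that by (simp add: cdf_def measure_def)
    have "cdf (\<kappa> x) y = cdf (\<kappa>' x) y" for y
    proof (rule antisym; rule field_le_epsilon)
      fix e :: real assume e: "0 < e"
      have "\<forall>\<^sub>F z in at_right y. cdf (\<kappa> x) z < cdf (\<kappa> x) y + e"
        using k.cdf_is_right_cont[of y] e unfolding continuous_within by (intro order_tendstoD(2)) auto
      moreover have "\<forall>\<^sub>F z in at_right y. cdf (\<kappa>' x) z < cdf (\<kappa>' x) y + e"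
        using k'.cdf_is_right_cont[of y] e unfolding continuous_within by (intro order_tendstoD(2)) auto
      ultimately have "\<forall>\<^sub>F z in at_right y. cdf (\<kappa> x) z < cdf (\<kappa> x) y + e \<and> cdf (\<kappa>' x) z < cdf (\<kappa>' x) y + e"
        by eventually_elim auto
      then obtain b where b: "y < b" "\<And>z. y < z \<Longrightarrow> z < b \<Longrightarrow> cdf (\<kappa> x) z < cdf (\<kappa> x) y + e \<and> cdf (\<kappa>' x) z < cdf (\<kappa>' x) y + e"
        by (auto simp: eventually_at_right_field)
      obtain q where q: "q \<in> \<rat>" "y < q" "q < b" using Rats_dense_in_real[OF b(1)] by auto
      show "cdf (\<kappa> x) y \<le> cdf (\<kappa>' x) y + e"
        using b(2)[OF q(2,3)] *[OF q(1)] k.cdf_nondecreasing[of y q] q by linarith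
      show "cdf (\<kappa>' x) y \<le> cdf (\<kappa> x) y + e"
        using b(2)[OF q(2,3)] *[OF q(1)] k'.cdf_nondecreasing[of y q] q by linarith
    qed
    then show "\<kappa> x = \<kappa>' x" using cdf_unique[OF rd] by auto
  qed
qed

text \<open>Lower left quadrants form an intersection-stable generator of the Borel sets of the plane.\<close>

lemma disintegratesI_atMost:
  fixes \<pi> :: "(real \<times> real) measure"
  assumes \<mu>: "prob_space \<mu>" "sets \<mu> = sets borel" and \<pi>: "finite_measure \<pi>" "sets \<pi> = sets (borel \<Otimes>\<^sub>M borel)"
    and K: "\<kappa> \<in> \<mu> \<rightarrow>\<^sub>M prob_algebra borel"
    and eq: "\<And>a y. emeasure \<pi> ({..a} \<times> {..y}) = (\<integral>\<^sup>+x\<in>{..a}. emeasure (\<kappa> x) {..y} \<partial>\<mu>)"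
  shows "disintegrates borel \<mu> \<pi> \<kappa>"
proof -
  interpret \<mu>: prob_space \<mu> by fact
  interpret \<pi>: finite_measure \<pi> by fact
  have [measurable_cong]: "sets \<mu> = sets borel" by fact
  have sp\<mu>: "space \<mu> = UNIV" using sets_eq_imp_space_eq[OF \<mu>(2)] by simp
  define K2 where "K2 = (\<lambda>x. distr (\<kappa> x) (borel \<Otimes>\<^sub>M borel) (Pair x))"
  have K2: "K2 \<in> \<mu> \<rightarrow>\<^sub>M subprob_algebra (borel \<Otimes>\<^sub>M borel)"
    unfolding K2_def
    by (intro measurable_prob_algebraD measurable_distr_prob_space2[where M=borel] K) measurable
  have S[simp]: "sets (\<kappa> x) = sets borel" "space (\<kappa> x) = UNIV" for x
    using measurable_space[OF K, of x] sp\<mu> by (auto simp: space_prob_algebra dest: sets_eq_imp_space_eq)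
  have K2C: "emeasure (K2 x) C = emeasure (\<kappa> x) (Pair x -` C)" if "C \<in> sets (borel \<Otimes>\<^sub>M borel)" for x C
    unfolding K2_def using that by (subst emeasure_distr) (auto cong: measurable_cong_sets)
  have bind: "emeasure (\<mu> \<bind> K2) C = (\<integral>\<^sup>+x. emeasure (\<kappa> x) (Pair x -` C) \<partial>\<mu>)"
    if "C \<in> sets (borel \<Otimes>\<^sub>M borel)" for C
    using emeasure_bind[OF _ K2 that] sp\<mu> K2C[OF that] by simp
  let ?E = "range (\<lambda>p::real \<times> real. {..p})"
  have E: "sets (borel :: (real \<times> real) measure) = sigma_sets UNIV ?E"
    by (subst borel_eq_atMost) (simp add: sets_measure_of)
  have box: "{..p} = {..fst p} \<times> {..snd p}" for p :: "real \<times> real"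
    by (auto simp: less_eq_prod_def)
  have "\<pi> = \<mu> \<bind> K2"
  proof (rule measure_eqI_generator_eq[where \<Omega>=UNIV and E="?E" and A="\<lambda>n. {..(real n, real n)}"])
    show "Int_stable ?E"
    proof (intro Int_stableI)
      fix a b assume "a \<in> ?E" "b \<in> ?E"
      then obtain p q where pq: "a = {..p}" "b = {..q}" by auto
      have "{..p} \<inter> {..q} = {..(min (fst p) (fst q), min (snd p) (snd q))}"
        by (auto simp: less_eq_prod_def)
      then show "a \<inter> b \<in> ?E" using pq by auto
    qed
    show "sets \<pi> = sigma_sets UNIV ?E" by (simp only: \<pi>(2) borel_prod E)
    show "sets (\<mu> \<bind> K2) = sigma_sets UNIV ?E"
    proof -
      have "sets (\<mu> \<bind> K2) = sets (borel \<Otimes>\<^sub>M borel)"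
        using sp\<mu> by (intro sets_bind sets_kernel[OF K2]) auto
      then show ?thesis by (simp only: borel_prod E)
    qed
    show "(\<Union>n. {..(real n, real n)}) = (UNIV :: (real \<times> real) set)"
    proof (intro set_eqI iffI UNIV_I)
      fix z :: "real \<times> real"
      obtain n where "max (fst z) (snd z) \<le> real n" using real_arch_simple by blast
      then show "z \<in> (\<Union>n. {..(real n, real n)})" by (auto simp: less_eq_prod_def)
    qed
    fix X assume "X \<in> ?E"
    then obtain p where X: "X = {..fst p} \<times> {..snd p}" using box by auto
    have "emeasure (\<mu> \<bind> K2) X = (\<integral>\<^sup>+x. emeasure (\<kappa> x) (Pair x -` X) \<partial>\<mu>)"
      unfolding X by (rule bind) auto
    also have "\<dots> = (\<integral>\<^sup>+x\<in>{..fst p}. emeasure (\<kappa> x) {..snd p} \<partial>\<mu>)"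
      by (intro nn_integral_cong) (auto simp: X split: split_indicator)
    finally show "emeasure \<pi> X = emeasure (\<mu> \<bind> K2) X" using eq X by simp
  qed (auto)
  moreover have "sets (\<mu> \<Otimes>\<^sub>M borel) = sets (borel \<Otimes>\<^sub>M (borel :: real measure))"
    by (intro sets_pair_measure_cong \<mu>) simp
  ultimately show ?thesis
    unfolding disintegrates_def using K bind by auto
qed

text \<open>The density \<open>g y\<close> of \<open>A \<mapsto> \<pi> (A \<times> {..y})\<close> with respect to the first marginal is a candidate for the conditional
distribution function at \<open>y\<close>. Outside a null set it is monotone with limits 0 and 1 along the rationals, hence has
right limits that form a distribution function \<open>F x\<close>; the kernel consists of the associated Stieltjes measures.
On the null set an arbitrary distribution (the point mass at 0) is used. That \<open>F x y\<close> is again a version of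
\<open>g y x\<close> follows by squeezing it between \<open>g y x\<close> and \<open>g q x\<close> for rationals \<open>q\<close> decreasing to \<open>y\<close>.\<close>

lemma disintegrates_exists:
  fixes \<pi> :: "(real \<times> real) measure"
  assumes \<pi>: "prob_space \<pi>" "sets \<pi> = sets (borel \<Otimes>\<^sub>M borel)"
    and \<mu>: "sets \<mu> = sets borel" "distr \<pi> \<mu> fst = \<mu>"
  shows "\<exists>\<kappa>. disintegrates borel \<mu> \<pi> \<kappa>"
proof -
  have [measurable_cong]: "sets \<mu> = sets borel" "sets \<pi> = sets (borel \<Otimes>\<^sub>M borel)" by fact+
  interpret \<pi>: prob_space \<pi> by fact
  have "fst \<in> \<pi> \<rightarrow>\<^sub>M \<mu>" by measurable
  then interpret \<mu>: prob_space \<mu> using \<pi>.prob_space_distr \<mu>(2) by metis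
  have sp[simp]: "space \<mu> = UNIV" "space \<pi> = UNIV"
    using sets_eq_imp_space_eq[OF \<mu>(1)] sets_eq_imp_space_eq[OF \<pi>(2)] by (auto simp: space_pair_measure)
  have em\<mu>: "emeasure \<mu> A = emeasure \<pi> (A \<times> UNIV)" if "A \<in> sets borel" for A
  proof -
    have "emeasure \<mu> A = emeasure (distr \<pi> \<mu> fst) A" using \<mu>(2) by simp
    also have "\<dots> = emeasure \<pi> (fst -` A \<inter> space \<pi>)" using that by (intro emeasure_distr) auto
    also have "fst -` A \<inter> space \<pi> = A \<times> UNIV" by auto
    finally show ?thesis .
  qed
  define N where "N y = distr (density \<pi> (indicator (UNIV \<times> {..y}))) borel fst" for y :: real
  have N: "emeasure (N y) A = emeasure \<pi> (A \<times> {..y})" if [measurable]: "A \<in> sets borel" for A y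
  proof -
    have "emeasure (N y) A = emeasure (density \<pi> (indicator (UNIV \<times> {..y}))) (fst -` A \<inter> UNIV)"
      unfolding N_def by (subst emeasure_distr) auto
    also have "\<dots> = (\<integral>\<^sup>+z. indicator (UNIV \<times> {..y}) z * indicator (fst -` A \<inter> UNIV) z \<partial>\<pi>)"
      by (subst emeasure_density) (auto intro!: measurable_sets[OF measurable_fst that, of borel, simplified space_pair_measure, simplified]
            simp: \<pi>(2))
    also have "\<dots> = (\<integral>\<^sup>+z. indicator (A \<times> {..y}) z \<partial>\<pi>)"
      by (intro nn_integral_cong) (auto split: split_indicator)
    also have "\<dots> = emeasure \<pi> (A \<times> {..y})" by simp
    finally show ?thesis .
  qed
  define g where "g y = RN_deriv \<mu> (N y)" for y
  have g[measurable]: "g y \<in> borel_measurable borel" for y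
    unfolding g_def using borel_measurable_RN_deriv[of \<mu> "N y"] by (simp cong: measurable_cong_sets add: \<mu>(1))
  have int_g: "(\<integral>\<^sup>+x\<in>A. g y x \<partial>\<mu>) = emeasure \<pi> (A \<times> {..y})" if [measurable]: "A \<in> sets borel" for A y
  proof -
    have "absolutely_continuous \<mu> (N y)"
    proof (unfold absolutely_continuous_def, rule subsetI)
      fix B assume "B \<in> null_sets \<mu>"
      then have B: "B \<in> sets borel" "emeasure \<mu> B = 0" using \<mu>(1) by auto
      have "emeasure \<pi> (B \<times> {..y}) \<le> emeasure \<pi> (B \<times> UNIV)"
        using B(1) by (intro emeasure_mono) auto
      then show "B \<in> null_sets (N y)" using B em\<mu>[OF B(1)] N[OF B(1)] by (auto simp: N_def)
    qed
    then have "density \<mu> (g y) = N y"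
      unfolding g_def by (intro \<mu>.density_RN_deriv) (auto simp: N_def \<mu>(1))
    then have "emeasure (density \<mu> (g y)) A = emeasure \<pi> (A \<times> {..y})" using N by simp
    then show ?thesis by (subst (asm) emeasure_density) auto
  qed
  have int_g': "(\<integral>\<^sup>+x. g y x \<partial>\<mu>) = emeasure \<pi> (UNIV \<times> {..y})" for y
    using int_g[of UNIV y] by simp
  have mono: "AE x in \<mu>. g q x \<le> g r x" if "q \<le> r" for q r
    using that by (intro AE_le_if_set_nn_integral_le)
      (auto simp: int_g int_g' less_top[symmetric] \<mu>(1) intro!: emeasure_mono pair_measureI)
  have le1: "AE x in \<mu>. g q x \<le> 1" for q
    by (intro AE_le_if_set_nn_integral_le)
      (auto simp: int_g int_g' em\<mu> \<mu>(1) \<mu>.emeasure_space_1[simplified] intro!: emeasure_mono pair_measureI)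
  have top: "AE x in \<mu>. 1 \<le> (SUP n. g (real n) x)"
  proof (intro AE_le_if_set_nn_integral_le)
    have inc: "AE x in \<mu>. g (real n) x \<le> g (real (Suc n)) x" for n by (rule mono) simp
    have bound: "AE x in \<mu>. (SUP n. g (real n) x) \<le> 1"
    proof -
      have "AE x in \<mu>. \<forall>n::nat. g (real n) x \<le> 1" using le1 by (simp add: AE_all_countable)
      then show ?thesis by eventually_elim (auto intro: SUP_least)
    qed
    have "(\<integral>\<^sup>+x. (SUP n. g (real n) x) \<partial>\<mu>) \<le> (\<integral>\<^sup>+x. 1 \<partial>\<mu>)" using bound by (rule nn_integral_mono_AE)
    then show "(\<integral>\<^sup>+x. (SUP n. g (real n) x) \<partial>\<mu>) < \<infinity>" using \<mu>.emeasure_space_1 by (auto simp: le_less_trans)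
    fix A assume "A \<in> sets \<mu>"
    then have A[measurable]: "A \<in> sets borel" using \<mu>(1) by simp
    have "(\<integral>\<^sup>+x\<in>A. 1 \<partial>\<mu>) = emeasure \<pi> (A \<times> UNIV)" using em\<mu>[OF A] by (simp add: \<mu>(1))
    also have "A \<times> UNIV = (\<Union>n. A \<times> {..real n})" using real_arch_simple by auto
    also have "emeasure \<pi> \<dots> = (SUP n. emeasure \<pi> (A \<times> {..real n}))"
      by (intro SUP_emeasure_incseq[symmetric]) (auto simp: incseq_def)
    also have "\<dots> = (SUP n. \<integral>\<^sup>+x\<in>A. g (real n) x \<partial>\<mu>)" by (simp add: int_g)
    also have "\<dots> = (\<integral>\<^sup>+x. (SUP n. g (real n) x * indicator A x) \<partial>\<mu>)"
    proof (intro nn_integral_monotone_convergence_SUP_AE[symmetric])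
      show "AE x in \<mu>. g (real n) x * indicator A x \<le> g (real (Suc n)) x * indicator A x" for n
        using inc[of n] by eventually_elim (auto split: split_indicator)
    qed measurable
    also have "\<dots> \<le> (\<integral>\<^sup>+x\<in>A. (SUP n. g (real n) x) \<partial>\<mu>)"
      by (intro nn_integral_mono) (auto split: split_indicator)
    finally show "(\<integral>\<^sup>+x\<in>A. 1 \<partial>\<mu>) \<le> (\<integral>\<^sup>+x\<in>A. (SUP n. g (real n) x) \<partial>\<mu>)" .
  qed measurable
  have bot: "AE x in \<mu>. (INF n. g (- real n) x) = 0"
  proof -
    have dec: "AE x in \<mu>. g (- real (Suc n)) x \<le> g (- real n) x" for n by (rule mono) simp
    have "(\<integral>\<^sup>+x. (INF n. g (- real n) x) \<partial>\<mu>) = (INF n. \<integral>\<^sup>+x. g (- real n) x \<partial>\<mu>)"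
      using dec by (intro nn_integral_monotone_convergence_INF_AE') (auto simp: int_g' less_top[symmetric])
    also have "\<dots> = (INF n. emeasure \<pi> (UNIV \<times> {..- real n}))" by (simp add: int_g')
    also have "\<dots> = emeasure \<pi> (\<Inter>n. UNIV \<times> {..- real n})"
      by (intro INF_emeasure_decseq) (auto simp: decseq_def)
    also have "(\<Inter>n. UNIV \<times> {..- real n}) = ({} :: (real \<times> real) set)"
    proof -
      have "\<exists>n::nat. \<not> y \<le> - real n" for y
        using reals_Archimedean2[of "- y"] by (metis minus_le_iff neg_le_iff_le not_le)
      then show ?thesis by auto
    qed
    finally have "(\<integral>\<^sup>+x. (INF n. g (- real n) x) \<partial>\<mu>) = 0" by simp
    then show ?thesis by (subst (asm) nn_integral_0_iff_AE) auto
  qed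
  define good where "good x \<longleftrightarrow> (\<forall>q\<in>\<rat>. \<forall>r\<in>\<rat>. q \<le> r \<longrightarrow> g q x \<le> g r x) \<and> (\<forall>q\<in>\<rat>. g q x \<le> 1) \<and>
      1 \<le> (SUP n. g (real n) x) \<and> (INF n. g (- real n) x) = 0" for x
  have good_meas[measurable]: "Measurable.pred borel good"
    unfolding good_def using countable_rat by measurable
  have AE_good: "AE x in \<mu>. good x"
  proof -
    have "AE x in \<mu>. \<forall>q\<in>\<rat>. \<forall>r\<in>\<rat>. q \<le> r \<longrightarrow> g q x \<le> g r x"
      using mono by (subst AE_ball_countable[OF countable_rat], intro ballI, subst AE_ball_countable[OF countable_rat], auto)
    moreover have "AE x in \<mu>. \<forall>q\<in>\<rat>. g q x \<le> 1"
      using le1 by (subst AE_ball_countable[OF countable_rat]) auto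
    ultimately show ?thesis using top bot unfolding good_def by eventually_elim auto
  qed
  define h where "h x q = (if good x then enn2real (g q x) else if 0 \<le> q then 1 else 0)" for x q
  have gh: "g q x = ennreal (h x q)" if "good x" "q \<in> \<rat>" for q x
  proof -
    have "g q x \<le> 1" using that by (auto simp: good_def)
    then have "g q x < top" by (rule le_less_trans) simp
    then show ?thesis using that(1) by (simp add: h_def)
  qed
  define F where "F x y = (INF q\<in>{q\<in>\<rat>. y < q}. h x q)" for x y
  have h: "\<And>q r. q \<in> \<rat> \<Longrightarrow> r \<in> \<rat> \<Longrightarrow> q \<le> r \<Longrightarrow> h x q \<le> h x r"
      "\<And>q. q \<in> \<rat> \<Longrightarrow> 0 \<le> h x q \<and> h x q \<le> 1"
      "\<And>e. 0 < e \<Longrightarrow> \<exists>n::nat. 1 - e < h x (real n)"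
      "\<And>e. 0 < e \<Longrightarrow> \<exists>n::nat. h x (- real n) < e" for x
  proof -
    show b: "0 \<le> h x q \<and> h x q \<le> 1" if "q \<in> \<rat>" for q
    proof (cases "good x")
      case True
      then have "g q x \<le> 1" using that by (auto simp: good_def)
      then show ?thesis by (auto simp: h_def True intro!: enn2real_leI)
    qed (auto simp: h_def)
    show "h x q \<le> h x r" if "q \<in> \<rat>" "r \<in> \<rat>" "q \<le> r" for q r
    proof (cases "good x")
      case True
      then have "g q x \<le> g r x" using that by (auto simp: good_def)
      with gh[OF True] that b show ?thesis by auto
    qed (use that in \<open>auto simp: h_def\<close>)
    fix e :: real assume e: "0 < e"
    show "\<exists>n::nat. 1 - e < h x (real n)"
    proof (cases "good x")
      case True
      have "ennreal (1 - e) < 1" using e ennreal_lessI[of 1 "1 - e"] by simp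
      then have "ennreal (1 - e) < (SUP n. g (real n) x)" using True unfolding good_def by (meson less_le_trans)
      then obtain n :: nat where "ennreal (1 - e) < g (real n) x" by (auto simp: less_SUP_iff)
      with gh[OF True, of "real n"] b[of "real n"] show ?thesis
        by (intro exI[of _ n]) (metis Rats_of_nat ennreal_less_iff ennreal_neg leI less_le_trans not_le order.strict_implies_order zero_less_iff_neq_zero less_irrefl)
    qed (use e in \<open>auto simp: h_def\<close>)
    show "\<exists>n::nat. h x (- real n) < e"
    proof (cases "good x")
      case True
      then have "(INF n. g (- real n) x) < ennreal e" using e by (auto simp: good_def)
      then obtain n :: nat where "g (- real n) x < ennreal e" by (auto simp: INF_less_iff)
      with gh[OF True, of "- real n"] b[of "- real n"] show ?thesis
        by (intro exI[of _ n]) (auto simp: ennreal_less_iff)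
    qed (use e in \<open>auto simp: h_def intro!: exI[of _ "1::nat"]\<close>)
  qed
  note F = cdf_from_rationals[OF h, folded F_def]
  define \<kappa> where "\<kappa> x = interval_measure (F x)" for x
  have \<kappa>_Iic: "emeasure (\<kappa> x) {..y} = ennreal (F x y)" for x y
    unfolding \<kappa>_def by (rule emeasure_interval_measure_Iic[OF F(1-3)])
  have h_meas[measurable]: "(\<lambda>x. h x q) \<in> borel_measurable borel" for q
    unfolding h_def by measurable
  have F_meas[measurable]: "(\<lambda>x. F x y) \<in> borel_measurable borel" for y
    unfolding F_def
  proof (rule borel_measurable_cINF)
    show "countable {q \<in> \<rat>. y < q}" by (rule countable_subset[OF _ countable_rat]) auto
    show "bdd_below ((\<lambda>q. h x q) ` {q \<in> \<rat>. y < q})" for x using h(2) by (auto intro!: bdd_belowI[of _ 0])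
  qed measurable
  have K: "\<kappa> \<in> \<mu> \<rightarrow>\<^sub>M prob_algebra borel"
  proof (rule measurable_prob_algebra_generated[where \<Omega>=UNIV and G="range (\<lambda>y::real. {..y})"])
    show "sets borel = sigma_sets UNIV (range (\<lambda>y::real. {..y}))"
      by (subst borel_eq_atMost) (simp add: sets_measure_of)
    show "Int_stable (range (\<lambda>y::real. {..y}))" by (auto simp: Int_stable_def)
    show "prob_space (\<kappa> x)" for x
      unfolding \<kappa>_def using real_distribution_interval_measure[OF F] by (auto simp: real_distribution_def)
    show "sets (\<kappa> x) = sets borel" for x by (simp add: \<kappa>_def)
    show "(\<lambda>x. emeasure (\<kappa> x) A) \<in> borel_measurable \<mu>" if "A \<in> range (\<lambda>y::real. {..y})" for A
      using that by (auto simp: \<kappa>_Iic)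
  qed auto
  \<comment> \<open>The two halves of the squeezing argument.\<close>
  have lower: "AE x in \<mu>. g y x \<le> ennreal (F x y)" for y
  proof -
    have "AE x in \<mu>. \<forall>q\<in>{q\<in>\<rat>. y < q}. g y x \<le> g q x"
      using mono by (subst AE_ball_countable) (auto intro: countable_subset[OF _ countable_rat])
    with AE_good show ?thesis
    proof eventually_elim
      case (elim x)
      obtain q0 where q0: "q0 \<in> \<rat>" "y < q0" using Rats_dense_in_real[of y "y + 1"] by auto
      have fin: "g y x < \<infinity>" using elim(2) gh[OF elim(1) q0(1)] q0 by (auto intro: le_less_trans)
      have "enn2real (g y x) \<le> F x y"
        unfolding F_def
      proof (rule cINF_greatest)
        show "{q \<in> \<rat>. y < q} \<noteq> {}" using q0 by auto
        fix q assume q: "q \<in> {q \<in> \<rat>. y < q}"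
        then have "g y x \<le> ennreal (h x q)" using elim gh by auto
        then show "enn2real (g y x) \<le> h x q" using h(2)[of q x] q by (auto intro: enn2real_leI)
      qed
      then show ?case using fin by (metis ennreal_enn2real ennreal_leI infinity_ennreal_def)
    qed
  qed
  have upper: "AE x in \<mu>. ennreal (F x y) \<le> g q x" if "q \<in> \<rat>" "y < q" for y q
    using AE_good
  proof eventually_elim
    case (elim x)
    have "F x y \<le> h x q"
      unfolding F_def using h(2) that by (intro cINF_lower bdd_belowI[of _ 0]) auto
    then show ?case using gh[OF elim that(1)] by (auto intro: ennreal_leI)
  qed
  have "disintegrates borel \<mu> \<pi> \<kappa>"
  proof (rule disintegratesI_atMost[OF \<mu>.prob_space_axioms \<mu>(1) \<pi>.finite_measure_axioms \<pi>(2) K])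
    fix a y :: real
    have "emeasure \<pi> ({..a} \<times> {..y}) = (\<integral>\<^sup>+x\<in>{..a}. g y x \<partial>\<mu>)" by (simp add: int_g)
    also have "\<dots> \<le> (\<integral>\<^sup>+x\<in>{..a}. emeasure (\<kappa> x) {..y} \<partial>\<mu>)"
      using lower[of y] by (intro nn_integral_mono_AE) (auto simp: \<kappa>_Iic split: split_indicator)
    finally have 1: "emeasure \<pi> ({..a} \<times> {..y}) \<le> (\<integral>\<^sup>+x\<in>{..a}. emeasure (\<kappa> x) {..y} \<partial>\<mu>)" .
    have "(\<integral>\<^sup>+x\<in>{..a}. emeasure (\<kappa> x) {..y} \<partial>\<mu>) \<le> (INF n. emeasure \<pi> ({..a} \<times> {..y + 1 / Suc n}))"
    proof (rule INF_greatest)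
      fix n :: nat
      obtain q where q: "q \<in> \<rat>" "y < q" "q < y + 1 / Suc n"
        using Rats_dense_in_real[of y "y + 1 / Suc n"] by auto
      have "(\<integral>\<^sup>+x\<in>{..a}. emeasure (\<kappa> x) {..y} \<partial>\<mu>) \<le> (\<integral>\<^sup>+x\<in>{..a}. g q x \<partial>\<mu>)"
        using upper[OF q(1,2)] by (intro nn_integral_mono_AE) (auto simp: \<kappa>_Iic split: split_indicator)
      also have "\<dots> = emeasure \<pi> ({..a} \<times> {..q})" by (simp add: int_g)
      also have "\<dots> \<le> emeasure \<pi> ({..a} \<times> {..y + 1 / Suc n})"
        using q by (intro emeasure_mono) auto
      finally show "(\<integral>\<^sup>+x\<in>{..a}. emeasure (\<kappa> x) {..y} \<partial>\<mu>) \<le> emeasure \<pi> ({..a} \<times> {..y + 1 / Suc n})" .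
    qed
    also have "\<dots> = emeasure \<pi> (\<Inter>n. {..a} \<times> {..y + 1 / Suc n})"
    proof (intro INF_emeasure_decseq)
      have "1 / real (Suc n) \<le> 1 / real (Suc m)" if "m \<le> n" for m n
        using that by (simp add: field_simps)
      then show "decseq (\<lambda>n. {..a} \<times> {..y + 1 / real (Suc n)})"
        unfolding decseq_def by (meson Sigma_mono add_left_mono atMost_subset_iff order_refl)
    qed auto
    also have "(\<Inter>n. {..a} \<times> {..y + 1 / Suc n}) = {..a} \<times> {..y}"
    proof -
      have "z \<le> y" if "\<And>n. z \<le> y + 1 / Suc n" for z
        by (rule field_le_epsilon) (metis that add_left_mono less_eq_real_def nat_approx_posE order_trans)
      moreover have "z \<le> y + 1 / Suc n" if "z \<le> y" for z n
        using that by (smt (verit) divide_nonneg_nonneg of_nat_0_le_iff)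
      ultimately show ?thesis by auto
    qed
    finally show "emeasure \<pi> ({..a} \<times> {..y}) = (\<integral>\<^sup>+x\<in>{..a}. emeasure (\<kappa> x) {..y} \<partial>\<mu>)"
      using 1 by (intro antisym)
  qed
  then show ?thesis by blast
qed

section \<open>Bounds for the Wasserstein distance\<close>

lemma borel_kernelD:
  assumes "K \<in> M \<rightarrow>\<^sub>M prob_algebra (borel :: real measure)" "x \<in> space M"
  shows "prob_space (K x)" "sets (K x) = sets borel" "space (K x) = UNIV"
  using measurable_space[OF assms] by (auto simp: space_prob_algebra dest: sets_eq_imp_space_eq)

text \<open>Under any coupling, the distance between the coordinates integrates to at least the difference of their means.
Equality holds as soon as some coupling moves all mass in the same direction, which is what the constant sign
below provides.\<close>

lemma wasserstein1_ge_mean_difference: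
  assumes p: "integrable p (\<lambda>x. x)" "sets p = sets borel" and q: "integrable q (\<lambda>x. x)" "sets q = sets borel"
  shows "ennreal \<bar>(\<integral>x. x \<partial>p) - (\<integral>x. x \<partial>q)\<bar> \<le> wasserstein1 p q"
  unfolding wasserstein1_def
proof (rule INF_greatest)
  fix \<gamma> assume "\<gamma> \<in> couplings p q"
  then have \<gamma>: "sets \<gamma> = sets (p \<Otimes>\<^sub>M q)" "distr \<gamma> p fst = p" "distr \<gamma> q snd = q"
    by (auto simp: couplings_def)
  have m: "fst \<in> \<gamma> \<rightarrow>\<^sub>M p" "snd \<in> \<gamma> \<rightarrow>\<^sub>M q"
    unfolding measurable_cong_sets[OF \<gamma>(1) refl] by (rule measurable_fst measurable_snd)+
  have idp: "(\<lambda>x. x) \<in> borel_measurable p" and idq: "(\<lambda>x. x) \<in> borel_measurable q"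
    using p(2) q(2) by (simp_all cong: measurable_cong_sets)
  have i: "integrable \<gamma> (\<lambda>z. fst z)" "integrable \<gamma> (\<lambda>z. snd z)"
    using integrable_distr[OF m(1), unfolded \<gamma>(2), OF p(1)] integrable_distr[OF m(2), unfolded \<gamma>(3), OF q(1)]
    by auto
  have "(\<integral>x. x \<partial>p) = (\<integral>z. fst z \<partial>\<gamma>)" "(\<integral>x. x \<partial>q) = (\<integral>z. snd z \<partial>\<gamma>)"
    using integral_distr[OF m(1) idp] integral_distr[OF m(2) idq] \<gamma>(2,3) by auto
  then have "\<bar>(\<integral>x. x \<partial>p) - (\<integral>x. x \<partial>q)\<bar> = \<bar>\<integral>z. fst z - snd z \<partial>\<gamma>\<bar>" using i by simp
  also have "\<dots> \<le> (\<integral>z. \<bar>fst z - snd z\<bar> \<partial>\<gamma>)" by (rule integral_abs_bound)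
  finally have "ennreal \<bar>(\<integral>x. x \<partial>p) - (\<integral>x. x \<partial>q)\<bar> \<le> ennreal (\<integral>z. \<bar>fst z - snd z\<bar> \<partial>\<gamma>)" by (rule ennreal_leI)
  also have "\<dots> = (\<integral>\<^sup>+z. ennreal \<bar>fst z - snd z\<bar> \<partial>\<gamma>)"
    using i by (intro nn_integral_eq_integral[symmetric]) auto
  finally show "ennreal \<bar>(\<integral>x. x \<partial>p) - (\<integral>x. x \<partial>q)\<bar> \<le> (\<integral>\<^sup>+ (x, y). ennreal \<bar>x - y\<bar> \<partial>\<gamma>)"
    by (simp add: case_prod_unfold)
qed

text \<open>Draw a common parameter \<open>u\<close> from \<open>U\<close> and then a point from \<open>K u\<close>, to be paired with \<open>f u\<close>: this is a coupling of the
two mixtures.\<close>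

lemma wasserstein1_bind_le:
  assumes U: "U \<in> space (prob_algebra N)" and f: "f \<in> N \<rightarrow>\<^sub>M borel" and K: "K \<in> N \<rightarrow>\<^sub>M prob_algebra borel"
  shows "wasserstein1 (distr U borel f) (U \<bind> K) \<le> (\<integral>\<^sup>+u. \<integral>\<^sup>+z. ennreal \<bar>f u - z\<bar> \<partial>K u \<partial>U)"
proof -
  interpret prob_space U using U by (simp add: space_prob_algebra)
  have [measurable_cong]: "sets U = sets N" using U by (simp add: space_prob_algebra)
  have sp: "space U = space N" by (rule sets_eq_imp_space_eq) fact
  note f[measurable] K[measurable]
  have KU: "K \<in> U \<rightarrow>\<^sub>M prob_algebra borel" by measurable
  note kD = borel_kernelD[OF KU]
  define J where "J = (\<lambda>u. distr (K u) (borel \<Otimes>\<^sub>M borel) (Pair (f u)))"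
  have J[measurable]: "J \<in> U \<rightarrow>\<^sub>M prob_algebra (borel \<Otimes>\<^sub>M borel)"
    unfolding J_def by measurable
  have UU: "U \<in> space (prob_algebra U)" by (simp add: space_prob_algebra prob_space_axioms)
  note J' = measurable_prob_algebraD[OF J]
  define \<gamma> where "\<gamma> = U \<bind> J"
  have \<gamma>p: "prob_space \<gamma>" and \<gamma>s: "sets \<gamma> = sets (borel \<Otimes>\<^sub>M borel)"
    unfolding \<gamma>_def using prob_space_bind'[OF UU J] sets_bind'[OF UU J] by auto
  have sb: "sets (U \<bind> K) = sets borel"
    by (rule sets_bind'[OF UU KU])
  have "distr \<gamma> (distr U borel f) fst = distr \<gamma> borel fst" by (auto cong: distr_cong)
  also have "\<dots> = U \<bind> (\<lambda>u. distr (J u) borel fst)"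
    unfolding \<gamma>_def using not_empty by (subst distr_bind[OF J']) auto
  also have "\<dots> = U \<bind> (\<lambda>u. return borel (f u))"
  proof (rule bind_cong[OF refl])
    fix u assume u: "u \<in> space U"
    note kD = kD[OF u]
    have "distr (J u) borel fst = distr (K u) borel (\<lambda>_. f u)"
      unfolding J_def using kD by (subst distr_distr) (auto simp: comp_def cong: measurable_cong_sets)
    also have "\<dots> = return borel (f u)"
      by (rule prob_space.distr_const[OF kD(1)]) simp
    finally show "distr (J u) borel fst = return borel (f u)" .
  qed
  also have "\<dots> = distr U borel f" using not_empty by (intro bind_return_distr') auto
  finally have 1: "distr \<gamma> (distr U borel f) fst = distr U borel f" .
  have "distr \<gamma> (U \<bind> K) snd = distr \<gamma> borel snd" using sb by (auto cong: distr_cong)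
  also have "\<dots> = U \<bind> (\<lambda>u. distr (J u) borel snd)"
    unfolding \<gamma>_def using not_empty by (subst distr_bind[OF J']) auto
  also have "\<dots> = U \<bind> K"
  proof (rule bind_cong[OF refl])
    fix u assume u: "u \<in> space U"
    note kD = kD[OF u]
    show "distr (J u) borel snd = K u"
      unfolding J_def using kD distr_id2[of borel "K u"]
      by (subst distr_distr) (auto simp: comp_def id_def cong: measurable_cong_sets)
  qed
  finally have 2: "distr \<gamma> (U \<bind> K) snd = U \<bind> K" .
  have "\<gamma> \<in> couplings (distr U borel f) (U \<bind> K)"
    unfolding couplings_def using \<gamma>p 1 2 \<gamma>s sb by (auto intro!: sets_pair_measure_cong)
  then have "wasserstein1 (distr U borel f) (U \<bind> K) \<le> (\<integral>\<^sup>+ (x, y). ennreal \<bar>x - y\<bar> \<partial>\<gamma>)"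
    unfolding wasserstein1_def by (rule INF_lower)
  also have "\<dots> = (\<integral>\<^sup>+u. \<integral>\<^sup>+ (x, y). ennreal \<bar>x - y\<bar> \<partial>J u \<partial>U)"
    unfolding \<gamma>_def by (intro nn_integral_bind[OF _ J']) measurable
  also have "\<dots> = (\<integral>\<^sup>+u. \<integral>\<^sup>+z. ennreal \<bar>f u - z\<bar> \<partial>K u \<partial>U)"
  proof (rule nn_integral_cong)
    fix u assume u: "u \<in> space U"
    show "(\<integral>\<^sup>+ (x, y). ennreal \<bar>x - y\<bar> \<partial>J u) = (\<integral>\<^sup>+z. ennreal \<bar>f u - z\<bar> \<partial>K u)"
      unfolding J_def using kD[OF u] by (subst nn_integral_distr) (auto cong: measurable_cong_sets)
  qed
  finally show ?thesis .
qed

text \<open>The Bochner counterpart of the formula for nonnegative integrals, for integrands that need not be bounded.\<close>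

lemma integral_bind_real:
  fixes f :: "'b \<Rightarrow> real"
  assumes K: "K \<in> M \<rightarrow>\<^sub>M subprob_algebra N" and f: "f \<in> borel_measurable N" and ne: "space M \<noteq> {}"
    and fin: "(\<integral>\<^sup>+u. \<integral>\<^sup>+z. ennreal \<bar>f z\<bar> \<partial>K u \<partial>M) < \<infinity>"
  shows "integrable (M \<bind> K) f" "(\<integral>z. f z \<partial>(M \<bind> K)) = (\<integral>u. \<integral>z. f z \<partial>K u \<partial>M)"
proof -
  note K[measurable] f[measurable]
  have fm: "f \<in> borel_measurable (M \<bind> K)"
    using sets_bind[OF sets_kernel[OF K] ne] by (simp cong: measurable_cong_sets add: f)
  show i: "integrable (M \<bind> K) f"
    unfolding integrable_iff_bounded using fin fm by (auto simp: nn_integral_bind[OF _ K])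
  have nnm: "(\<lambda>u. \<integral>\<^sup>+z. ennreal (g z) \<partial>K u) \<in> borel_measurable M" if "g \<in> borel_measurable N" for g :: "'b \<Rightarrow> real"
    using that by measurable
  have fin_g: "(\<integral>\<^sup>+u. \<integral>\<^sup>+z. ennreal (g z) \<partial>K u \<partial>M) < \<infinity>" if "\<And>z. g z \<le> \<bar>f z\<bar>" for g
    by (rule le_less_trans[OF _ fin]) (intro nn_integral_mono ennreal_leI that)
  have AEfin: "AE u in M. (\<integral>\<^sup>+z. ennreal (g z) \<partial>K u) < \<infinity>"
    if "g \<in> borel_measurable N" "\<And>z. g z \<le> \<bar>f z\<bar>" for g
    using nn_integral_PInf_AE[OF nnm[OF that(1)]] fin_g[OF that(2)] by (auto simp: less_top)
  have part: "integrable M (\<lambda>u. enn2real (\<integral>\<^sup>+z. ennreal (g z) \<partial>K u)) \<and>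
      (\<integral>u. enn2real (\<integral>\<^sup>+z. ennreal (g z) \<partial>K u) \<partial>M) = enn2real (\<integral>\<^sup>+z. ennreal (g z) \<partial>(M \<bind> K))"
    if g: "g \<in> borel_measurable N" "\<And>z. g z \<le> \<bar>f z\<bar>" for g
  proof -
    have "(\<integral>\<^sup>+u. ennreal (enn2real (\<integral>\<^sup>+z. ennreal (g z) \<partial>K u)) \<partial>M) = (\<integral>\<^sup>+u. \<integral>\<^sup>+z. ennreal (g z) \<partial>K u \<partial>M)"
      using AEfin[OF g] by (intro nn_integral_cong_AE) (auto elim!: eventually_mono)
    also have "\<dots> = (\<integral>\<^sup>+z. ennreal (g z) \<partial>(M \<bind> K))"
      using g by (intro nn_integral_bind[symmetric, OF _ K]) measurable
    finally have eq: "(\<integral>\<^sup>+u. ennreal (enn2real (\<integral>\<^sup>+z. ennreal (g z) \<partial>K u)) \<partial>M) = (\<integral>\<^sup>+z. ennreal (g z) \<partial>(M \<bind> K))" .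
    moreover have "(\<integral>\<^sup>+z. ennreal (g z) \<partial>(M \<bind> K)) < \<infinity>"
      using g fin_g[OF g(2)] by (subst nn_integral_bind[OF _ K]) auto
    ultimately show ?thesis
      using nnm[OF g(1)]
      by (auto simp: integrable_iff_bounded integral_eq_nn_integral)
  qed
  have "(\<integral>u. \<integral>z. f z \<partial>K u \<partial>M) =
      (\<integral>u. enn2real (\<integral>\<^sup>+z. ennreal (f z) \<partial>K u) - enn2real (\<integral>\<^sup>+z. ennreal (- f z) \<partial>K u) \<partial>M)"
  proof (rule integral_cong_AE)
    show "AE u in M. (\<integral>z. f z \<partial>K u) = enn2real (\<integral>\<^sup>+z. ennreal (f z) \<partial>K u) - enn2real (\<integral>\<^sup>+z. ennreal (- f z) \<partial>K u)"
      using AEfin[of "\<lambda>z. \<bar>f z\<bar>", simplified] AE_space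
    proof eventually_elim
      case (elim u)
      have "integrable (K u) f"
        unfolding integrable_iff_bounded using elim sets_kernel[OF K elim(2)]
        by (auto cong: measurable_cong_sets)
      then show ?case by (rule real_lebesgue_integral_def)
    qed
  qed (use nnm[of f] nnm[of "\<lambda>z. - f z"] in measurable)
  also have "\<dots> = (\<integral>z. f z \<partial>(M \<bind> K))"
    using part[of f] part[of "\<lambda>z. - f z"] real_lebesgue_integral_def[OF i] by (simp add: f)
  finally show "(\<integral>z. f z \<partial>(M \<bind> K)) = (\<integral>u. \<integral>z. f z \<partial>K u \<partial>M)" ..
qed

section \<open>Barycentres of disintegrations\<close>

lemma couplings_borelD:
  fixes \<mu> \<nu> :: "real measure"
  assumes "\<pi> \<in> couplings \<mu> \<nu>" "sets \<mu> = sets borel" "sets \<nu> = sets borel"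
  shows "prob_space \<pi>" "sets \<pi> = sets (borel \<Otimes>\<^sub>M borel)" "distr \<pi> \<mu> fst = \<mu>" "distr \<pi> \<nu> snd = \<nu>"
    "fst \<in> \<pi> \<rightarrow>\<^sub>M \<mu>" "snd \<in> \<pi> \<rightarrow>\<^sub>M \<nu>"
proof -
  show "prob_space \<pi>" "distr \<pi> \<mu> fst = \<mu>" "distr \<pi> \<nu> snd = \<nu>"
    using assms(1) by (auto simp: couplings_def)
  show s: "sets \<pi> = sets (borel \<Otimes>\<^sub>M borel)"
    using assms unfolding couplings_def by (auto intro!: sets_pair_measure_cong)
  show "fst \<in> \<pi> \<rightarrow>\<^sub>M \<mu>" "snd \<in> \<pi> \<rightarrow>\<^sub>M \<nu>"
    by (simp_all cong: measurable_cong_sets add: s assms)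
qed

lemma P1D:
  assumes "\<mu> \<in> P1"
  shows "real_distribution \<mu>" "prob_space \<mu>" "sets \<mu> = sets borel" "space \<mu> = UNIV" "integrable \<mu> (\<lambda>x. x)"
  using assms unfolding P1_def
  by (auto simp: real_distribution_def real_distribution_axioms_def dest: sets_eq_imp_space_eq)

lemma disintegration_disintegrates:
  assumes "\<mu> \<in> P1" "\<nu> \<in> P1" "\<pi> \<in> couplings \<mu> \<nu>"
  shows "disintegrates borel \<mu> \<pi> (disintegration \<mu> \<pi>)"
proof -
  note c = couplings_borelD[OF assms(3) P1D(3)[OF assms(1)] P1D(3)[OF assms(2)]]
  show ?thesis
    unfolding disintegration_def
  by (rule someI_ex[OF disintegrates_exists[OF c(1,2) P1D(3)[OF assms(1)] c(3)]])
qed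

lemma AE_disintegration_integrable:
  assumes \<mu>: "\<mu> \<in> P1" and \<nu>: "\<nu> \<in> P1" and \<pi>: "\<pi> \<in> couplings \<mu> \<nu>"
  shows "AE x in \<mu>. integrable (disintegration \<mu> \<pi> x) (\<lambda>y. y)"
proof -
  note \<pi>D = couplings_borelD[OF \<pi> P1D(3)[OF \<mu>] P1D(3)[OF \<nu>]]
  let ?\<kappa> = "disintegration \<mu> \<pi>"
  have d: "disintegrates borel \<mu> \<pi> ?\<kappa>" by (rule disintegration_disintegrates[OF assms])
  have K[measurable]: "?\<kappa> \<in> \<mu> \<rightarrow>\<^sub>M prob_algebra borel" using d by (simp add: disintegrates_def)
  have [measurable_cong]: "sets \<mu> = sets borel" "sets \<nu> = sets borel" using P1D \<mu> \<nu> by auto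
  have s: "sets \<pi> = sets (\<mu> \<Otimes>\<^sub>M borel)"
    unfolding \<pi>D(2) using P1D(3)[OF \<mu>] by (intro sets_pair_measure_cong) auto
  have "(\<integral>\<^sup>+x. \<integral>\<^sup>+y. ennreal \<bar>y\<bar> \<partial>?\<kappa> x \<partial>\<mu>) = (\<integral>\<^sup>+z. ennreal \<bar>snd z\<bar> \<partial>\<pi>)"
    using nn_integral_disintegrates[OF d s, of "\<lambda>z. ennreal \<bar>snd z\<bar>"] P1D(4)[OF \<mu>] by simp
  also have "\<dots> = (\<integral>\<^sup>+y. ennreal \<bar>y\<bar> \<partial>distr \<pi> \<nu> snd)"
    using \<pi>D(6) by (subst nn_integral_distr) auto
  also have "\<dots> < \<infinity>"
    unfolding \<pi>D(4) using P1D(5)[OF \<nu>] by (simp add: integrable_iff_bounded)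
  finally have "(\<integral>\<^sup>+x. \<integral>\<^sup>+y. ennreal \<bar>y\<bar> \<partial>?\<kappa> x \<partial>\<mu>) \<noteq> \<infinity>" by simp
  moreover have "(\<lambda>x. \<integral>\<^sup>+y. ennreal \<bar>y\<bar> \<partial>?\<kappa> x) \<in> borel_measurable \<mu>"
    by (rule nn_integral_measurable_subprob_algebra2[OF _ measurable_prob_algebraD[OF K]]) simp
  ultimately have "AE x in \<mu>. (\<integral>\<^sup>+y. ennreal \<bar>y\<bar> \<partial>?\<kappa> x) \<noteq> \<infinity>"
    by (intro nn_integral_PInf_AE)
  then show ?thesis
    using AE_space
  proof eventually_elim
    case (elim x)
    then show ?case
      using borel_kernelD[OF K elim(2)] by (auto simp: integrable_iff_bounded less_top cong: measurable_cong_sets)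
  qed
qed

text \<open>For a martingale coupling the barycentre of \<open>M\<^sub>x\<^sub>'\<close> is \<open>x'\<close>. Hence \<open>\<bar>x - x'\<bar> + W\<^sub>1(\<pi>\<^sub>x, M\<^sub>x\<^sub>')\<close> is bounded below by
\<open>\<bar>x - x'\<bar>\<close> plus the distance from the barycentre of \<open>\<pi>\<^sub>x\<close> to \<open>x'\<close>, and by the triangle inequality by the distance from
\<open>x\<close> to the barycentre of \<open>\<pi>\<^sub>x\<close>. This bound no longer involves \<open>M\<close> or the coupling of the first marginals.\<close>

lemma adapted_wasserstein1_ge_barycentre_distance:
  assumes \<mu>: "\<mu> \<in> P1" and \<nu>: "\<nu> \<in> P1" and \<pi>: "\<pi> \<in> couplings \<mu> \<nu>" and M: "M \<in> martingale_couplings \<mu> \<nu>"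
  shows "(\<integral>\<^sup>+x. ennreal \<bar>x - (\<integral>y. y \<partial>disintegration \<mu> \<pi> x)\<bar> \<partial>\<mu>) \<le> adapted_wasserstein1 \<mu> \<pi> M"
  unfolding adapted_wasserstein1_def
proof (rule INF_greatest)
  let ?b = "\<lambda>x. \<integral>y. y \<partial>disintegration \<mu> \<pi> x"
  fix \<gamma> assume \<gamma>: "\<gamma> \<in> couplings \<mu> \<mu>"
  note \<gamma>D = couplings_borelD[OF \<gamma> P1D(3)[OF \<mu>] P1D(3)[OF \<mu>]]
  have M': "M \<in> couplings \<mu> \<nu>" and mart: "AE x in \<mu>. (\<integral>y. y \<partial>disintegration \<mu> M x) = x"
    using M by (auto simp: martingale_couplings_def)
  have [measurable_cong]: "sets \<mu> = sets borel" using P1D \<mu> by auto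
  have K: "disintegration \<mu> \<rho> \<in> \<mu> \<rightarrow>\<^sub>M prob_algebra borel" if "\<rho> \<in> couplings \<mu> \<nu>" for \<rho>
    using disintegration_disintegrates[OF \<mu> \<nu> that] by (simp add: disintegrates_def)
  note sb = borel_kernelD(2)[OF K]
  have AE_marginal: "AE z in \<gamma>. P (fst z)" "AE z in \<gamma>. P (snd z)" if P: "AE x in \<mu>. P x" for P
  proof -
    have "AE x in distr \<gamma> \<mu> fst. P x" "AE x in distr \<gamma> \<mu> snd. P x" 
      unfolding \<gamma>D(3,4) by (rule P)+
    from AE_distrD[OF \<gamma>D(5) this(1)] AE_distrD[OF \<gamma>D(6) this(2)]
    show "AE z in \<gamma>. P (fst z)" "AE z in \<gamma>. P (snd z)" .
  qed
  have AE1: "AE z in \<gamma>. integrable (disintegration \<mu> \<pi> (fst z)) (\<lambda>y. y)"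
    using AE_disintegration_integrable[OF \<mu> \<nu> \<pi>] by (rule AE_marginal(1))
  have AE2: "AE z in \<gamma>. integrable (disintegration \<mu> M (snd z)) (\<lambda>y. y) \<and> (\<integral>y. y \<partial>disintegration \<mu> M (snd z)) = snd z"
    using AE_conjI[OF AE_disintegration_integrable[OF \<mu> \<nu> M'] mart] by (rule AE_marginal(2))
  have [measurable]: "?b \<in> borel_measurable \<mu>"
    by (rule measurable_compose[OF measurable_prob_algebraD[OF K[OF \<pi>]] integral_measurable_subprob_algebra]) simp
  have "(\<integral>\<^sup>+x. ennreal \<bar>x - ?b x\<bar> \<partial>\<mu>) = (\<integral>\<^sup>+x. ennreal \<bar>x - ?b x\<bar> \<partial>distr \<gamma> \<mu> fst)"
    by (rule arg_cong[where f="\<lambda>N. \<integral>\<^sup>+x. ennreal \<bar>x - ?b x\<bar> \<partial>N", OF \<gamma>D(3)[symmetric]])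
  also have "\<dots> = (\<integral>\<^sup>+z. ennreal \<bar>fst z - ?b (fst z)\<bar> \<partial>\<gamma>)"
    by (rule nn_integral_distr[OF \<gamma>D(5)]) measurable
  also have "\<dots> \<le> (\<integral>\<^sup>+ (x, x'). ennreal \<bar>x - x'\<bar> + wasserstein1 (disintegration \<mu> \<pi> x) (disintegration \<mu> M x') \<partial>\<gamma>)"
  proof (rule nn_integral_mono_AE)
    show "AE z in \<gamma>. ennreal \<bar>fst z - ?b (fst z)\<bar>
      \<le> (case z of (x, x') \<Rightarrow> ennreal \<bar>x - x'\<bar> + wasserstein1 (disintegration \<mu> \<pi> x) (disintegration \<mu> M x'))"
      using AE1 AE2
    proof eventually_elim
      case (elim z)
      obtain x x' where z: "z = (x, x')" by (cases z)
      have sp: "x \<in> space \<mu>" "x' \<in> space \<mu>" using P1D(4)[OF \<mu>] by auto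
      have "ennreal \<bar>x - ?b x\<bar> \<le> ennreal (\<bar>x - x'\<bar> + \<bar>?b x - x'\<bar>)" by (intro ennreal_leI) linarith
      also have "\<dots> = ennreal \<bar>x - x'\<bar> + ennreal \<bar>?b x - x'\<bar>" by (intro ennreal_plus) auto
      also have "\<dots> \<le> ennreal \<bar>x - x'\<bar> + wasserstein1 (disintegration \<mu> \<pi> x) (disintegration \<mu> M x')"
        using wasserstein1_ge_mean_difference[of "disintegration \<mu> \<pi> x" "disintegration \<mu> M x'"] elim z
          sb[OF \<pi> sp(1)] sb[OF M' sp(2)] by (intro add_left_mono) auto
      finally show ?case by (simp add: z)
    qed
  qed
  finally show "(\<integral>\<^sup>+x. ennreal \<bar>x - ?b x\<bar> \<partial>\<mu>) \<le> \<dots>" .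
qed

section \<open>Fibres of a parametrization by the unit interval\<close>

lemma prob_space_unit_interval: "prob_space unit_interval"
  by (auto simp: emeasure_restrict_space space_restrict_space intro!: prob_spaceI)

lemma sets_unit_interval: "sets unit_interval = sets (restrict_space borel {0<..<1})"
  by (rule sets_restrict_space_cong) simp

lemma space_unit_interval: "space unit_interval = {0<..<1}"
  by (simp add: space_restrict_space)

lemma measurable_unit_intervalI: "f \<in> borel \<rightarrow>\<^sub>M N \<Longrightarrow> f \<in> unit_interval \<rightarrow>\<^sub>M N"
  by (rule measurable_restrict_space1) simp

text \<open>The joint law of \<open>f\<close> and its parameter. Its disintegration \<open>U\<close> describes the uniform parameter conditionally on the value
of \<open>f\<close>. For a quantile function, \<open>U x\<close> is the uniform law on \<open>(F(x-), F(x)]\<close> when \<open>x\<close> is an atom and the point mass at \<open>F(x)\<close>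
otherwise.\<close>

definition parametrized_law :: "(real \<Rightarrow> real) \<Rightarrow> (real \<times> real) measure" where
  "parametrized_law f = distr unit_interval (borel \<Otimes>\<^sub>M borel) (\<lambda>u. (f u, u))"

lemma measurable_graph_unit_interval:
  "f \<in> borel_measurable borel \<Longrightarrow> (\<lambda>u. (f u, u)) \<in> unit_interval \<rightarrow>\<^sub>M borel \<Otimes>\<^sub>M borel"
  by (rule measurable_unit_intervalI) simp

lemma fibre_kernel_exists:
  assumes f: "f \<in> borel_measurable borel" and \<mu>: "distr unit_interval borel f = \<mu>"
  shows "\<exists>U. disintegrates borel \<mu> (parametrized_law f) U"
proof (rule disintegrates_exists)
  have s: "sets \<mu> = sets borel" using \<mu> by auto
  show "prob_space (parametrized_law f)"
    unfolding parametrized_law_def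
    by (intro prob_space.prob_space_distr prob_space_unit_interval measurable_graph_unit_interval f)
  show "distr (parametrized_law f) \<mu> fst = \<mu>"
    unfolding parametrized_law_def
    by (subst distr_distr[OF _ measurable_graph_unit_interval[OF f]])
      (use \<mu> in \<open>auto simp: s comp_def cong: measurable_cong_sets distr_cong\<close>)
qed (use \<mu> in \<open>auto simp: parametrized_law_def\<close>)

context
  fixes f :: "real \<Rightarrow> real" and \<mu> :: "real measure" and U :: "real \<Rightarrow> real measure"
  assumes f[measurable]: "f \<in> borel_measurable borel"
    and law_f: "distr unit_interval borel f = \<mu>"
    and U: "disintegrates borel \<mu> (parametrized_law f) U"
begin

lemma sets_law: "sets \<mu> = sets borel" "space \<mu> = UNIV"
  using law_f by auto

lemma fibre_measurable: "U \<in> borel \<rightarrow>\<^sub>M prob_algebra borel"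
  using U sets_law by (simp add: disintegrates_def cong: measurable_cong_sets)

lemma nn_integral_fibre:
  assumes h: "h \<in> borel_measurable (borel \<Otimes>\<^sub>M borel)"
  shows "(\<integral>\<^sup>+x. \<integral>\<^sup>+u. h (x, u) \<partial>U x \<partial>\<mu>) = (\<integral>\<^sup>+u. h (f u, u) \<partial>unit_interval)"
proof -
  have s: "sets (\<mu> \<Otimes>\<^sub>M borel) = sets (borel \<Otimes>\<^sub>M (borel :: real measure))"
    by (intro sets_pair_measure_cong sets_law) simp
  have "(\<integral>\<^sup>+x. \<integral>\<^sup>+u. h (x, u) \<partial>U x \<partial>\<mu>) = (\<integral>\<^sup>+z. h z \<partial>parametrized_law f)"
    using h by (intro nn_integral_disintegrates[OF U, symmetric])
      (auto simp: parametrized_law_def s sets_law cong: measurable_cong_sets)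
  also have "\<dots> = (\<integral>\<^sup>+u. h (f u, u) \<partial>unit_interval)"
    unfolding parametrized_law_def
    by (rule nn_integral_distr[OF measurable_graph_unit_interval[OF f]]) (simp add: h)
  finally show ?thesis .
qed

text \<open>The law \<open>U x\<close> lives on the fibre of \<open>f\<close> over \<open>x\<close>, and a null set of parameters stays null for almost every \<open>U x\<close>.\<close>

lemma AE_fibre:
  assumes P: "AE u in unit_interval. P u"
  shows "AE x in \<mu>. AE u in U x. u \<in> {0<..<1} \<and> f u = x \<and> P u"
proof -
  obtain N where N: "{u\<in>space unit_interval. \<not> P u} \<subseteq> N" "emeasure unit_interval N = 0" "N \<in> sets unit_interval"
    using AE_E[OF P] by metis
  have N'[measurable]: "N \<in> sets borel"
    using N(3) by (auto simp: sets_restrict_space)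
  have "AE z in parametrized_law f. snd z \<in> {0<..<1} \<and> f (snd z) = fst z \<and> snd z \<notin> N"
    unfolding parametrized_law_def
  proof (subst AE_distr_iff[OF measurable_graph_unit_interval[OF f]])
    have "AE u in unit_interval. u \<notin> N" using N(2,3) by (intro AE_not_in) auto
    then show "AE u in unit_interval. snd (f u, u) \<in> {0<..<1} \<and> f (snd (f u, u)) = fst (f u, u) \<and> snd (f u, u) \<notin> N"
      using AE_space by eventually_elim (auto simp: space_unit_interval)
  qed measurable
  then have "AE (x, u) in parametrized_law f. u \<in> {0<..<1} \<and> f u = x \<and> P u"
    by eventually_elim (use N(1) in \<open>auto simp: space_unit_interval\<close>)
  moreover have "sets (\<mu> \<Otimes>\<^sub>M borel) = sets (borel \<Otimes>\<^sub>M (borel :: real measure))"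
    by (intro sets_pair_measure_cong sets_law) simp
  ultimately show ?thesis
    by (intro AE_disintegrates[OF U]) (auto simp: parametrized_law_def sets_law)
qed

text \<open>If \<open>R\<close> is obtained by drawing a uniform parameter \<open>u\<close> and then pairing \<open>f u\<close> with a point drawn from \<open>K u\<close>, then
conditioning on the first coordinate amounts to averaging \<open>K\<close> over the fibre.\<close>

lemma disintegrates_bind_fibre:
  fixes K :: "real \<Rightarrow> real measure"
  assumes K: "K \<in> borel \<rightarrow>\<^sub>M prob_algebra borel"
    and R: "\<And>C. C \<in> sets (borel \<Otimes>\<^sub>M borel) \<Longrightarrow>
      emeasure R C = (\<integral>\<^sup>+u. emeasure (K u) (Pair (f u) -` C) \<partial>unit_interval)"
  shows "disintegrates borel \<mu> R (\<lambda>x. U x \<bind> K)"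
  unfolding disintegrates_def
proof (intro conjI ballI)
  show "(\<lambda>x. U x \<bind> K) \<in> \<mu> \<rightarrow>\<^sub>M prob_algebra borel"
    using measurable_bind_prob_space[OF fibre_measurable K] by (simp add: sets_law cong: measurable_cong_sets)
  fix C assume "C \<in> sets (\<mu> \<Otimes>\<^sub>M (borel :: real measure))"
  moreover have "sets (\<mu> \<Otimes>\<^sub>M borel) = sets (borel \<Otimes>\<^sub>M (borel :: real measure))"
    by (intro sets_pair_measure_cong sets_law) simp
  ultimately have C[measurable]: "C \<in> sets (borel \<Otimes>\<^sub>M borel)" by simp
  have m: "(\<lambda>(x, u). emeasure (K u) (Pair x -` C)) \<in> borel_measurable (borel \<Otimes>\<^sub>M borel)"
  proof -
    have "(\<lambda>z. emeasure (K (snd z)) (Pair (fst z) -` C)) \<in> borel_measurable (borel \<Otimes>\<^sub>M borel)"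
    proof (rule emeasure_measurable_subprob_algebra2)
      have "(SIGMA z:space (borel \<Otimes>\<^sub>M borel). Pair (fst z) -` C) =
          {w \<in> space ((borel \<Otimes>\<^sub>M borel) \<Otimes>\<^sub>M borel). (fst (fst w), snd w) \<in> C}"
        by (auto simp: space_pair_measure)
      also have "\<dots> \<in> sets ((borel \<Otimes>\<^sub>M borel) \<Otimes>\<^sub>M borel)" by measurable
      finally show "(SIGMA z:space (borel \<Otimes>\<^sub>M borel). Pair (fst z) -` C) \<in> sets ((borel \<Otimes>\<^sub>M borel) \<Otimes>\<^sub>M borel)" .
      show "(\<lambda>z. K (snd z)) \<in> borel \<Otimes>\<^sub>M borel \<rightarrow>\<^sub>M subprob_algebra borel"
        using measurable_prob_algebraD[OF K] by measurable
    qed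
    then show ?thesis by (simp add: case_prod_unfold)
  qed
  have "(\<integral>\<^sup>+x. emeasure (U x \<bind> K) (Pair x -` C) \<partial>\<mu>) = (\<integral>\<^sup>+x. \<integral>\<^sup>+u. emeasure (K u) (Pair x -` C) \<partial>U x \<partial>\<mu>)"
  proof (rule nn_integral_cong)
    fix x
    show "emeasure (U x \<bind> K) (Pair x -` C) = (\<integral>\<^sup>+u. emeasure (K u) (Pair x -` C) \<partial>U x)"
      using measurable_space[OF fibre_measurable, of x]
      by (intro emeasure_bind_prob_algebra[OF _ K]) auto
  qed
  also have "\<dots> = (\<integral>\<^sup>+u. emeasure (K u) (Pair (f u) -` C) \<partial>unit_interval)"
    using nn_integral_fibre[OF m] by simp
  finally show "emeasure R C = (\<integral>\<^sup>+x. emeasure (U x \<bind> K) (Pair x -` C) \<partial>\<mu>)"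
    using R[OF C] by simp
qed

end

section \<open>Couplings assembled on the fibres\<close>

lemma diagonal_coupling:
  assumes "\<mu> \<in> P1"
  shows "distr \<mu> (\<mu> \<Otimes>\<^sub>M \<mu>) (\<lambda>x. (x, x)) \<in> couplings \<mu> \<mu>"
proof -
  interpret prob_space \<mu> by (rule P1D[OF assms])
  show ?thesis
    unfolding couplings_def by (auto intro!: prob_space_distr simp: distr_distr comp_def distr_id2)
qed

text \<open>The integrand in the definition of the adapted distance need not be measurable, so that the comparison
with \<open>H\<close> is made under the diagonal coupling itself, before changing variables.\<close>

lemma adapted_wasserstein1_le_diagonal:
  assumes \<mu>: "\<mu> \<in> P1" and H[measurable]: "H \<in> borel_measurable \<mu>"
    and le: "AE x in \<mu>. wasserstein1 (disintegration \<mu> \<pi> x) (disintegration \<mu> \<pi>' x) \<le> H x"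
  shows "adapted_wasserstein1 \<mu> \<pi> \<pi>' \<le> (\<integral>\<^sup>+x. H x \<partial>\<mu>)"
proof -
  have [measurable_cong]: "sets \<mu> = sets borel" by (rule P1D[OF \<mu>])
  let ?\<gamma> = "distr \<mu> (\<mu> \<Otimes>\<^sub>M \<mu>) (\<lambda>x. (x, x))"
  let ?W = "\<lambda>(x, x'). ennreal \<bar>x - x'\<bar> + wasserstein1 (disintegration \<mu> \<pi> x) (disintegration \<mu> \<pi>' x')"
  obtain N where N: "{x\<in>space \<mu>. \<not> wasserstein1 (disintegration \<mu> \<pi> x) (disintegration \<mu> \<pi>' x) \<le> H x} \<subseteq> N"
      "emeasure \<mu> N = 0" "N \<in> sets \<mu>"
    using AE_E[OF le] by metis
  note N(3)[measurable]
  have "AE z in ?\<gamma>. fst z = snd z \<and> fst z \<notin> N"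
  proof (subst AE_distr_iff)
    show "AE x in \<mu>. fst (x, x) = snd (x, x) \<and> fst (x, x) \<notin> N"
      using N(2,3) by (auto intro!: AE_not_in)
  qed measurable
  then have AE: "AE z in ?\<gamma>. ?W z \<le> H (fst z)"
    by eventually_elim (use N(1) P1D(4)[OF \<mu>] in auto)
  have "adapted_wasserstein1 \<mu> \<pi> \<pi>' \<le> (\<integral>\<^sup>+z. ?W z \<partial>?\<gamma>)"
    unfolding adapted_wasserstein1_def by (rule INF_lower[OF diagonal_coupling[OF \<mu>]])
  also have "\<dots> \<le> (\<integral>\<^sup>+z. H (fst z) \<partial>?\<gamma>)" by (rule nn_integral_mono_AE[OF AE])
  also have "\<dots> = (\<integral>\<^sup>+x. H x \<partial>\<mu>)" by (subst nn_integral_distr) measurable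
  finally show ?thesis .
qed

lemma unique_disintegration:
  assumes "\<mu> \<in> P1" "\<nu> \<in> P1" "\<pi> \<in> couplings \<mu> \<nu>" "disintegrates borel \<mu> \<pi> \<kappa>"
  shows "AE x in \<mu>. disintegration \<mu> \<pi> x = \<kappa> x"
proof -
  interpret prob_space \<mu> by (rule P1D[OF assms(1)])
  show ?thesis
    by (rule disintegrates_unique[OF _ disintegration_disintegrates[OF assms(1-3)] assms(4)]) unfold_locales
qed

text \<open>The barycentre of \<open>M\<^sub>x\<close> is the average over the fibre of the means of \<open>K u\<close>, and these all equal \<open>f u = x\<close>.\<close>

lemma martingale_coupling_from_fibres:
  fixes f :: "real \<Rightarrow> real"
  assumes \<mu>: "\<mu> \<in> P1" and \<nu>: "\<nu> \<in> P1"
    and f[measurable]: "f \<in> borel_measurable borel" and law_f: "distr unit_interval borel f = \<mu>"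
    and U: "disintegrates borel \<mu> (parametrized_law f) U"
    and K: "K \<in> borel \<rightarrow>\<^sub>M prob_algebra borel"
    and M: "M \<in> couplings \<mu> \<nu>"
    and M_eq: "\<And>C. C \<in> sets (borel \<Otimes>\<^sub>M borel) \<Longrightarrow>
      emeasure M C = (\<integral>\<^sup>+u. emeasure (K u) (Pair (f u) -` C) \<partial>unit_interval)"
    and mean: "AE u in unit_interval. integrable (K u) (\<lambda>z. z) \<and> (\<integral>z. z \<partial>K u) = f u"
  shows "M \<in> martingale_couplings \<mu> \<nu>"
proof -
  note fib = f law_f U
  have D: "disintegrates borel \<mu> M (\<lambda>x. U x \<bind> K)"
    by (rule disintegrates_bind_fibre[OF fib K M_eq])
  note U_meas = fibre_measurable[OF fib]
  note KS = measurable_prob_algebraD[OF K]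
  have "AE x in \<mu>. integrable (U x \<bind> K) (\<lambda>z. z)"
    using AE_disintegration_integrable[OF \<mu> \<nu> M] unique_disintegration[OF \<mu> \<nu> M D]
    by eventually_elim simp
  then have "AE x in \<mu>. (\<integral>y. y \<partial>disintegration \<mu> M x) = x"
    using unique_disintegration[OF \<mu> \<nu> M D] AE_fibre[OF fib mean]
  proof eventually_elim
    case (elim x)
    have Ux: "prob_space (U x)" "sets (U x) = sets borel" "space (U x) = UNIV"
      using borel_kernelD[OF U_meas, of x] by auto
    have KSx: "K \<in> U x \<rightarrow>\<^sub>M subprob_algebra borel" using KS Ux by (simp cong: measurable_cong_sets)
    have "(\<integral>\<^sup>+u. \<integral>\<^sup>+z. ennreal \<bar>z\<bar> \<partial>K u \<partial>U x) = (\<integral>\<^sup>+z. ennreal \<bar>z\<bar> \<partial>(U x \<bind> K))"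
      by (intro nn_integral_bind[OF _ KSx, symmetric]) simp
    also have "\<dots> < \<infinity>" using elim(1) by (simp add: integrable_iff_bounded)
    finally have "(\<integral>z. z \<partial>(U x \<bind> K)) = (\<integral>u. \<integral>z. z \<partial>K u \<partial>U x)"
      using Ux by (intro integral_bind_real[OF KSx]) auto
    also have "\<dots> = (\<integral>u. x \<partial>U x)"
    proof (rule integral_cong_AE)
      show "(\<lambda>u. \<integral>z. z \<partial>K u) \<in> borel_measurable (U x)"
        by (rule measurable_compose[OF KSx integral_measurable_subprob_algebra]) simp
      show "AE u in U x. (\<integral>z. z \<partial>K u) = x" using elim(3) by eventually_elim auto
    qed simp
    also have "\<dots> = x" using prob_space.prob_space[OF Ux(1)] by simp
    finally show ?case using elim(2) by simp
  qed
  with M show ?thesis by (simp add: martingale_couplings_def)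
qed

text \<open>With the diagonal coupling of the first marginals, both \<open>\<pi>\<^sub>x\<close> and \<open>M\<^sub>x\<close> are mixtures over the fibre of \<open>x\<close>, of the point masses at
\<open>g u\<close> and of the laws \<open>K u\<close>. Coupling them through the parameter costs the average of \<open>\<bar>x - g u\<bar>\<close> over the fibre.
As \<open>x - g u\<close> does not change sign there, this average is the distance from \<open>x\<close> to the barycentre of \<open>\<pi>\<^sub>x\<close>.\<close>

lemma adapted_wasserstein1_le_from_fibres:
  fixes f g :: "real \<Rightarrow> real"
  assumes \<mu>: "\<mu> \<in> P1" and \<nu>: "\<nu> \<in> P1"
    and f[measurable]: "f \<in> borel_measurable borel" and law_f: "distr unit_interval borel f = \<mu>"
    and g[measurable]: "g \<in> borel_measurable borel"
    and U: "disintegrates borel \<mu> (parametrized_law f) U"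
    and sign: "AE x in \<mu>. (AE u in U x. g u \<le> f u) \<or> (AE u in U x. f u \<le> g u)"
    and K: "K \<in> borel \<rightarrow>\<^sub>M prob_algebra borel"
    and \<pi>: "\<pi> \<in> couplings \<mu> \<nu>" and \<pi>_eq: "\<pi> = distr unit_interval (borel \<Otimes>\<^sub>M borel) (\<lambda>u. (f u, g u))"
    and M: "M \<in> couplings \<mu> \<nu>"
    and M_eq: "\<And>C. C \<in> sets (borel \<Otimes>\<^sub>M borel) \<Longrightarrow>
      emeasure M C = (\<integral>\<^sup>+u. emeasure (K u) (Pair (f u) -` C) \<partial>unit_interval)"
    and cost: "AE u in unit_interval. (\<integral>\<^sup>+z. ennreal \<bar>g u - z\<bar> \<partial>K u) = ennreal \<bar>f u - g u\<bar>"
  shows "adapted_wasserstein1 \<mu> \<pi> M \<le> (\<integral>\<^sup>+x. ennreal \<bar>x - (\<integral>y. y \<partial>disintegration \<mu> \<pi> x)\<bar> \<partial>\<mu>)"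
proof (rule adapted_wasserstein1_le_diagonal[OF \<mu>])
  note fib = f law_f U
  have [measurable_cong]: "sets \<mu> = sets borel" by (rule P1D[OF \<mu>])
  have G: "(\<lambda>u. return borel (g u)) \<in> borel \<rightarrow>\<^sub>M prob_algebra borel" by measurable
  have D\<pi>: "disintegrates borel \<mu> \<pi> (\<lambda>x. U x \<bind> (\<lambda>u. return borel (g u)))"
  proof (rule disintegrates_bind_fibre[OF fib G])
    fix C :: "(real \<times> real) set" assume C[measurable]: "C \<in> sets (borel \<Otimes>\<^sub>M borel)"
    have fg: "(\<lambda>u. (f u, g u)) \<in> unit_interval \<rightarrow>\<^sub>M borel \<Otimes>\<^sub>M borel" by (rule measurable_unit_intervalI) measurable
    have "emeasure \<pi> C = (\<integral>\<^sup>+z. indicator C z \<partial>\<pi>)" unfolding \<pi>_eq by simp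
    also have "\<dots> = (\<integral>\<^sup>+u. indicator C (f u, g u) \<partial>unit_interval)"
      unfolding \<pi>_eq by (rule nn_integral_distr[OF fg]) simp
    also have "\<dots> = (\<integral>\<^sup>+u. emeasure (return borel (g u)) (Pair (f u) -` C) \<partial>unit_interval)"
    proof (rule nn_integral_cong)
      fix u show "indicator C (f u, g u) = emeasure (return borel (g u)) (Pair (f u) -` C)"
        using sets_Pair1[OF C, of "f u"] by (simp split: split_indicator)
    qed
    finally show "emeasure \<pi> C = \<dots>" .
  qed
  have DM: "disintegrates borel \<mu> M (\<lambda>x. U x \<bind> K)"
    by (rule disintegrates_bind_fibre[OF fib K M_eq])
  have K\<pi>: "disintegration \<mu> \<pi> \<in> \<mu> \<rightarrow>\<^sub>M prob_algebra borel"
    using disintegration_disintegrates[OF \<mu> \<nu> \<pi>] by (simp add: disintegrates_def)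
  have [measurable]: "(\<lambda>x. \<integral>y. y \<partial>disintegration \<mu> \<pi> x) \<in> borel_measurable \<mu>"
    by (rule measurable_compose[OF measurable_prob_algebraD[OF K\<pi>] integral_measurable_subprob_algebra]) simp
  show "(\<lambda>x. ennreal \<bar>x - (\<integral>y. y \<partial>disintegration \<mu> \<pi> x)\<bar>) \<in> borel_measurable \<mu>" by measurable
  note U_meas = fibre_measurable[OF fib]
  \<comment> \<open>Almost everywhere, the two disintegrations may be replaced by the explicit fibre averages.\<close>
  show "AE x in \<mu>. wasserstein1 (disintegration \<mu> \<pi> x) (disintegration \<mu> M x)
      \<le> ennreal \<bar>x - (\<integral>y. y \<partial>disintegration \<mu> \<pi> x)\<bar>"
    using unique_disintegration[OF \<mu> \<nu> M DM] unique_disintegration[OF \<mu> \<nu> \<pi> D\<pi>]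
      AE_disintegration_integrable[OF \<mu> \<nu> \<pi>] AE_fibre[OF fib cost] sign
  proof eventually_elim
    case (elim x)
    have Ux: "prob_space (U x)" "sets (U x) = sets borel" "space (U x) = UNIV" "U x \<in> space (prob_algebra borel)"
      using borel_kernelD[OF U_meas, of x] measurable_space[OF U_meas, of x] by auto
    interpret Ux: prob_space "U x" by fact
    have gx: "g \<in> borel_measurable (U x)" using g Ux by (simp cong: measurable_cong_sets)
    have \<pi>x: "disintegration \<mu> \<pi> x = distr (U x) borel g"
      unfolding elim(2) using Ux gx by (intro bind_return_distr') auto
    have ig: "integrable (U x) g"
      using elim(3) gx unfolding \<pi>x by (simp add: integrable_distr_eq)
    have b: "(\<integral>y. y \<partial>disintegration \<mu> \<pi> x) = (\<integral>u. g u \<partial>U x)"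
      unfolding \<pi>x using gx by (simp add: integral_distr)
    have "wasserstein1 (disintegration \<mu> \<pi> x) (disintegration \<mu> M x)
        \<le> (\<integral>\<^sup>+u. \<integral>\<^sup>+z. ennreal \<bar>g u - z\<bar> \<partial>K u \<partial>U x)"
      unfolding elim(1) \<pi>x by (rule wasserstein1_bind_le[OF Ux(4) g K])
    also have "\<dots> = (\<integral>\<^sup>+u. ennreal \<bar>x - g u\<bar> \<partial>U x)"
    proof (rule nn_integral_cong_AE)
      show "AE u in U x. (\<integral>\<^sup>+z. ennreal \<bar>g u - z\<bar> \<partial>K u) = ennreal \<bar>x - g u\<bar>"
        using elim(4) by eventually_elim auto
    qed
    also have "\<dots> = ennreal (\<integral>u. \<bar>x - g u\<bar> \<partial>U x)"
      using ig by (intro nn_integral_eq_integral) auto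
    also have "(\<integral>u. \<bar>x - g u\<bar> \<partial>U x) = \<bar>\<integral>u. x - g u \<partial>U x\<bar>"
      using elim(5)
    proof
      assume "AE u in U x. g u \<le> f u"
      with elim(4) have *: "AE u in U x. 0 \<le> x - g u" by eventually_elim auto
      have "(\<integral>u. \<bar>x - g u\<bar> \<partial>U x) = (\<integral>u. x - g u \<partial>U x)"
        using * gx by (intro integral_cong_AE) auto
      with integral_nonneg_AE[OF *] show ?thesis by simp
    next
      assume "AE u in U x. f u \<le> g u"
      with elim(4) have *: "AE u in U x. 0 \<le> - (x - g u)" by eventually_elim auto
      have "(\<integral>u. \<bar>x - g u\<bar> \<partial>U x) = (\<integral>u. - (x - g u) \<partial>U x)"
        using * gx by (intro integral_cong_AE) auto
      also have "\<dots> = - (\<integral>u. x - g u \<partial>U x)" by (rule integral_minus)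
      finally show ?thesis
        using integral_nonneg_AE[OF *, unfolded integral_minus] by linarith
    qed
    also have "(\<integral>u. x - g u \<partial>U x) = x - (\<integral>u. g u \<partial>U x)"
      using ig Ux.prob_space by simp
    finally show ?case by (simp add: b)
  qed
qed

text \<open>The parameters \<open>u\<close> with \<open>f u = x\<close> lie in \<open>[F(x-), F(x)]\<close>. If \<open>x\<close> is not an atom, this is a single point. If \<open>x\<close> is an atom,
only the left end point can escape the interval \<open>(F(x-), F(x)]\<close> on which the sign is constant; as there are
countably many atoms, these left end points form a null set.\<close>

lemma AE_fibre_constant_sign:
  assumes \<mu>: "\<mu> \<in> P1"
    and f: "f \<in> borel_measurable borel" and law_f: "distr unit_interval borel f = \<mu>"
    and U: "disintegrates borel \<mu> (parametrized_law f) U"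
    and f_eq: "\<And>u. u \<in> {0<..<1} \<Longrightarrow> f u = quantile \<mu> u"
    and sign: "\<And>x. (\<forall>u \<in> {Lim (at_left x) (cdf \<mu>)<..cdf \<mu> x} \<inter> {0<..<1}. g u \<le> f u) \<or>
             (\<forall>u \<in> {Lim (at_left x) (cdf \<mu>)<..cdf \<mu> x} \<inter> {0<..<1}. f u \<le> g u)"
  shows "AE x in \<mu>. (AE u in U x. g u \<le> f u) \<or> (AE u in U x. f u \<le> g u)"
proof -
  interpret cdf_distribution \<mu> unfolding cdf_distribution_def by (rule P1D[OF \<mu>])
  have left_lim: "Lim (at_left x) (cdf \<mu>) = measure \<mu> {..<x}" for x
    using cdf_at_left by (intro tendsto_Lim) auto
  have split: "cdf \<mu> x = measure \<mu> {..<x} + measure \<mu> {x}" for x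
    unfolding cdf_def ivl_disj_un(2)[symmetric] by (subst finite_measure_Union) auto
  have q: "u \<le> cdf \<mu> y \<longleftrightarrow> f u \<le> y" if "u \<in> {0<..<1}" for u y
    using pseudoinverse[of u y] that f_eq[OF that] by (simp add: quantile_def)
  have lo: "measure \<mu> {..<f u} \<le> u" if "u \<in> {0<..<1}" for u
  proof (rule tendsto_upperbound[OF cdf_at_left[of "f u"]])
    have "cdf \<mu> y \<le> u" if "y < f u" for y
      using q[OF \<open>u \<in> {0<..<1}\<close>, of y] that by linarith
    then show "\<forall>\<^sub>F y in at_left (f u). cdf \<mu> y \<le> u"
      unfolding eventually_at_left_field by (intro exI[of _ "f u - 1"]) auto
  qed simp
  \<comment> \<open>the left end points of the intervals that belong to atoms\<close>
  define N where "N = (\<lambda>x. measure \<mu> {..<x}) ` {x. measure \<mu> {x} \<noteq> 0}"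
  have "countable N" unfolding N_def by (intro countable_image countable_support)
  then have "AE u in lborel. u \<notin> N" by (intro AE_not_in) (simp add: countable_imp_null_set_lborel)
  then have "AE u in unit_interval. u \<notin> N" by (subst AE_restrict_space_iff) auto
  from AE_fibre[OF f law_f U this] show ?thesis
  proof eventually_elim
    case (elim x)
    show ?case
    proof (cases "measure \<mu> {x} = 0")
      case True
      have "AE u in U x. u = cdf \<mu> x \<and> u \<in> {0<..<1}"
        using elim
      proof eventually_elim
        case (elim u)
        then show ?case using q[of u x] lo[of u] split[of x] True by auto
      qed
      then have eq: "AE u in U x. u = cdf \<mu> x" by eventually_elim simp
      show ?thesis
      proof (cases "g (cdf \<mu> x) \<le> f (cdf \<mu> x)")
        case True
        from eq have "AE u in U x. g u \<le> f u" by eventually_elim (use True in simp)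
        then show ?thesis ..
      next
        case False
        from eq have "AE u in U x. f u \<le> g u" by eventually_elim (use False in simp)
        then show ?thesis ..
      qed
    next
      case False
      have in_interval: "AE u in U x. u \<in> {Lim (at_left x) (cdf \<mu>)<..cdf \<mu> x} \<inter> {0<..<1}"
        using elim
      proof eventually_elim
        case (elim u)
        then have "u \<noteq> measure \<mu> {..<x}" using False by (auto simp: N_def)
        with elim show ?case using q[of u x] lo[of u] by (auto simp: left_lim)
      qed
      from sign[of x] show ?thesis
      proof
        assume *: "\<forall>u \<in> {Lim (at_left x) (cdf \<mu>)<..cdf \<mu> x} \<inter> {0<..<1}. g u \<le> f u"
        from in_interval have "AE u in U x. g u \<le> f u" by eventually_elim (use * in blast)
        then show ?thesis ..
      next
        assume *: "\<forall>u \<in> {Lim (at_left x) (cdf \<mu>)<..cdf \<mu> x} \<inter> {0<..<1}. f u \<le> g u"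
        from in_interval have "AE u in U x. f u \<le> g u" by eventually_elim (use * in blast)
        then show ?thesis ..
      qed
    qed
  qed
qed

section \<open>Mixtures of two-point martingale laws\<close>

text \<open>Both sides are integrals of \<open>f\<close> against a measure; the weights \<open>r\<close> and \<open>s\<close> may depend on the mixing variable.\<close>

lemma nn_integral_two_point_mixture:
  fixes z :: "'a \<Rightarrow> real" and r s :: "'a \<Rightarrow> ennreal"
  assumes [measurable]: "z \<in> borel_measurable \<kappa>" "r \<in> borel_measurable \<kappa>" "s \<in> borel_measurable \<kappa>"
    and m: "sets m = sets borel"
    and em: "\<And>B. B \<in> sets borel \<Longrightarrow> emeasure m B = (\<integral>\<^sup>+v. r v * indicator B (z v) + s v * indicator B y \<partial>\<kappa>)"
    and f: "f \<in> borel_measurable borel"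
  shows "(\<integral>\<^sup>+t. f t \<partial>m) = (\<integral>\<^sup>+v. r v * f (z v) + s v * f y \<partial>\<kappa>)"
proof -
  have "(\<integral>\<^sup>+t. g t \<partial>m) = (\<integral>\<^sup>+v. r v * g (z v) + s v * g y \<partial>\<kappa>)" if "g \<in> borel_measurable borel" for g
    using that
  proof (induction rule: borel_measurable_induct)
    case (cong f g)
    then show ?case by (simp cong: nn_integral_cong)
  next
    case (set A)
    then show ?case using em[OF set] m by simp
  next
    case (mult u c)
    then have [measurable]: "u \<in> borel_measurable borel" "u \<in> borel_measurable m" using m by (auto cong: measurable_cong_sets)
    have "(\<integral>\<^sup>+v. r v * (c * u (z v)) + s v * (c * u y) \<partial>\<kappa>) = (\<integral>\<^sup>+v. c * (r v * u (z v) + s v * u y) \<partial>\<kappa>)"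
      by (intro nn_integral_cong) (simp add: algebra_simps)
    then show ?case using mult by (simp add: nn_integral_cmult)
  next
    case (add u v)
    then have [measurable]: "u \<in> borel_measurable borel" "u \<in> borel_measurable m" "v \<in> borel_measurable borel" "v \<in> borel_measurable m"
      using m by (auto cong: measurable_cong_sets)
    have "(\<integral>\<^sup>+w. r w * (v (z w) + u (z w)) + s w * (v y + u y) \<partial>\<kappa>)
        = (\<integral>\<^sup>+w. (r w * v (z w) + s w * v y) + (r w * u (z w) + s w * u y) \<partial>\<kappa>)"
      by (intro nn_integral_cong) (simp add: algebra_simps)
    then show ?case using add by (simp add: nn_integral_add)
  next
    case (seq U)
    then have [measurable]: "U i \<in> borel_measurable borel" "U i \<in> borel_measurable m" for i
      using m by (auto cong: measurable_cong_sets)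
    have inc: "incseq (\<lambda>i. U i t)" for t using seq(3) by (auto simp: incseq_def le_fun_def)
    have "(\<integral>\<^sup>+t. (SUP i. U i) t \<partial>m) = (SUP i. \<integral>\<^sup>+t. U i t \<partial>m)"
      using nn_integral_monotone_convergence_SUP[of U m] seq(3) by (simp add: image_comp)
    also have "\<dots> = (SUP i. \<integral>\<^sup>+v. r v * U i (z v) + s v * U i y \<partial>\<kappa>)" using seq by simp
    also have "\<dots> = (\<integral>\<^sup>+v. (SUP i. r v * U i (z v) + s v * U i y) \<partial>\<kappa>)"
      using inc by (intro nn_integral_monotone_convergence_SUP[symmetric])
        (auto simp: incseq_def le_fun_def intro!: add_mono mult_left_mono)
    also have "\<dots> = (\<integral>\<^sup>+v. r v * (SUP i. U i) (z v) + s v * (SUP i. U i) y \<partial>\<kappa>)"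
    proof (intro nn_integral_cong)
      fix v
      have "(SUP i. r v * U i (z v) + s v * U i y) = (SUP i. r v * U i (z v)) + (SUP i. s v * U i y)"
        using inc by (intro ennreal_SUP_add) (auto simp: incseq_def intro!: mult_left_mono)
      then show "(SUP i. r v * U i (z v) + s v * U i y) = r v * (SUP i. U i) (z v) + s v * (SUP i. U i) y"
        by (simp add: SUP_mult_left_ennreal image_comp)
    qed
    finally show ?case .
  qed
  with f show ?thesis by simp
qed

context
  fixes a y :: real and \<kappa> :: "real measure" and z :: "real \<Rightarrow> real" and m :: "real measure"
  assumes \<kappa>: "prob_space \<kappa>" and z[measurable]: "z \<in> borel_measurable \<kappa>"
    and m: "prob_space m" "sets m = sets borel"
    and opposite: "AE v in \<kappa>. y < a \<and> a < z v \<or> z v < a \<and> a < y"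
    and m_eq: "\<And>B. B \<in> sets borel \<Longrightarrow> measure m B =
      (\<integral>v. (a - y) / (z v - y) * indicator B (z v) + (z v - a) / (z v - y) * indicator B y \<partial>\<kappa>)"
begin

lemma nn_integral_martingale_mixture:
  assumes f: "f \<in> borel_measurable borel"
  shows "(\<integral>\<^sup>+t. f t \<partial>m) = (\<integral>\<^sup>+v. ennreal ((a - y) / (z v - y)) * f (z v) + ennreal ((z v - a) / (z v - y)) * f y \<partial>\<kappa>)"
proof (rule nn_integral_two_point_mixture[OF _ _ _ m(2) _ f])
  interpret \<kappa>: prob_space \<kappa> by fact
  interpret m: prob_space m by fact
  fix B :: "real set" assume B[measurable]: "B \<in> sets borel"
  let ?r = "\<lambda>v. (a - y) / (z v - y)" and ?s = "\<lambda>v. (z v - a) / (z v - y)"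
  have rs: "AE v in \<kappa>. 0 \<le> ?r v \<and> 0 \<le> ?s v \<and> ?r v \<le> 1 \<and> ?s v \<le> 1"
    using opposite by eventually_elim (auto simp: divide_simps)
  have nonneg: "AE v in \<kappa>. 0 \<le> ?r v * indicator B (z v) + ?s v * indicator B y"
    using rs by eventually_elim (auto split: split_indicator)
  have "AE v in \<kappa>. norm (?r v * indicator B (z v) + ?s v * indicator B y) \<le> 2"
    using rs by eventually_elim (auto split: split_indicator)
  then have int: "integrable \<kappa> (\<lambda>v. ?r v * indicator B (z v) + ?s v * indicator B y)"
    by (intro \<kappa>.integrable_const_bound) measurable
  have "emeasure m B = ennreal (\<integral>v. ?r v * indicator B (z v) + ?s v * indicator B y \<partial>\<kappa>)"
    using m_eq[OF B] m.emeasure_eq_measure by simp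
  also have "\<dots> = (\<integral>\<^sup>+v. ennreal (?r v * indicator B (z v) + ?s v * indicator B y) \<partial>\<kappa>)"
    by (rule nn_integral_eq_integral[OF int nonneg, symmetric])
  also have "\<dots> = (\<integral>\<^sup>+v. ennreal (?r v) * indicator B (z v) + ennreal (?s v) * indicator B y \<partial>\<kappa>)"
  proof (rule nn_integral_cong_AE)
    show "AE v in \<kappa>. ennreal (?r v * indicator B (z v) + ?s v * indicator B y)
        = ennreal (?r v) * indicator B (z v) + ennreal (?s v) * indicator B y"
      using rs by eventually_elim (auto simp flip: ennreal_plus split: split_indicator)
  qed
  finally show "emeasure m B = \<dots>" .
qed measurable

text \<open>Under the law with atoms \<open>z v\<close> and \<open>y\<close> and mean \<open>a\<close>, the point \<open>z v\<close> has weight \<open>(a - y) / (z v - y)\<close>; so the mean of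
\<open>t - y\<close> is \<open>a - y\<close>, with \<open>t - y\<close> of constant sign, for every \<open>v\<close>.\<close>

lemma martingale_mixture_parts:
  "(\<integral>\<^sup>+t. ennreal (t - y) \<partial>m) = ennreal (a - y)" "(\<integral>\<^sup>+t. ennreal (y - t) \<partial>m) = ennreal (y - a)"
proof -
  interpret \<kappa>: prob_space \<kappa> by fact
  have "(\<integral>\<^sup>+t. ennreal (t - y) \<partial>m) = (\<integral>\<^sup>+v. ennreal (a - y) \<partial>\<kappa>)"
    unfolding nn_integral_martingale_mixture[of "\<lambda>t. ennreal (t - y)", simplified]
  proof (rule nn_integral_cong_AE)
    show "AE v in \<kappa>. ennreal ((a - y) / (z v - y)) * ennreal (z v - y) = ennreal (a - y)"
      using opposite by eventually_elim (auto simp: ennreal_mult'[symmetric] ennreal_neg)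
  qed
  then show "(\<integral>\<^sup>+t. ennreal (t - y) \<partial>m) = ennreal (a - y)" using \<kappa>.emeasure_space_1 by simp
  have "(\<integral>\<^sup>+t. ennreal (y - t) \<partial>m) = (\<integral>\<^sup>+v. ennreal (y - a) \<partial>\<kappa>)"
    unfolding nn_integral_martingale_mixture[of "\<lambda>t. ennreal (y - t)", simplified]
  proof (rule nn_integral_cong_AE)
    show "AE v in \<kappa>. ennreal ((a - y) / (z v - y)) * ennreal (y - z v) = ennreal (y - a)"
      using opposite
    proof eventually_elim
      case (elim v)
      then show ?case
      proof
        assume *: "z v < a \<and> a < y"
        then have "(a - y) / (z v - y) * (y - z v) = y - a" "0 \<le> (a - y) / (z v - y)"
          by (auto simp: field_simps)
        then show ?thesis by (metis ennreal_mult')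
      qed (auto simp: ennreal_neg)
    qed
  qed
  then show "(\<integral>\<^sup>+t. ennreal (y - t) \<partial>m) = ennreal (y - a)" using \<kappa>.emeasure_space_1 by simp
qed

lemma martingale_mixture_cost: "(\<integral>\<^sup>+t. ennreal \<bar>y - t\<bar> \<partial>m) = ennreal \<bar>a - y\<bar>"
proof -
  have [measurable_cong]: "sets m = sets borel" by (rule m)
  have "(\<integral>\<^sup>+t. ennreal \<bar>y - t\<bar> \<partial>m) = (\<integral>\<^sup>+t. ennreal (t - y) + ennreal (y - t) \<partial>m)"
    by (intro nn_integral_cong) (auto simp: abs_if ennreal_neg)
  also have "\<dots> = ennreal (a - y) + ennreal (y - a)"
    using martingale_mixture_parts by (subst nn_integral_add) auto
  also have "\<dots> = ennreal \<bar>a - y\<bar>" by (auto simp: abs_if ennreal_neg)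
  finally show ?thesis .
qed

lemma martingale_mixture_mean: "integrable m (\<lambda>t. t)" "(\<integral>t. t \<partial>m) = a"
proof -
  interpret m: prob_space m by fact
  have [measurable_cong]: "sets m = sets borel" by (rule m)
  have "integrable m (\<lambda>t. y - t)"
    unfolding integrable_iff_bounded using martingale_mixture_cost by auto
  then have i: "integrable m (\<lambda>t. t - y)" using integrable_minus[of m "\<lambda>t. y - t"] by simp
  then have "integrable m (\<lambda>t. (t - y) + y)" by (intro Bochner_Integration.integrable_add) auto
  then show im: "integrable m (\<lambda>t. t)" by simp
  have "(\<integral>t. t - y \<partial>m) = enn2real (\<integral>\<^sup>+t. ennreal (t - y) \<partial>m) - enn2real (\<integral>\<^sup>+t. ennreal (- (t - y)) \<partial>m)"
    by (rule real_lebesgue_integral_def[OF i])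
  also have "\<dots> = a - y"
    using martingale_mixture_parts by (cases "y \<le> a") (auto simp: ennreal_neg)
  finally show "(\<integral>t. t \<partial>m) = a" using im m.prob_space by simp
qed

text \<open>Compared with the point mass at \<open>y\<close>, the mixture has lost the mass \<open>\<bar>a - y\<bar> / \<bar>z v - y\<bar>\<close> at \<open>y\<close> and gained it at \<open>z v\<close>.
The identity is written without subtraction.\<close>

lemma emeasure_martingale_mixture_balance:
  assumes B[measurable]: "B \<in> sets borel"
  shows "emeasure m B + (\<integral>\<^sup>+v. ennreal \<bar>a - y\<bar> * (ennreal (1 / \<bar>z v - y\<bar>) * indicator B y) \<partial>\<kappa>)
    = indicator B y + (\<integral>\<^sup>+v. ennreal \<bar>a - y\<bar> * (ennreal (1 / \<bar>z v - y\<bar>) * indicator B (z v)) \<partial>\<kappa>)"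
proof -
  interpret \<kappa>: prob_space \<kappa> by fact
  let ?w = "\<lambda>v. ennreal \<bar>a - y\<bar> * ennreal (1 / \<bar>z v - y\<bar>)"
  have "emeasure m B = (\<integral>\<^sup>+t. indicator B t \<partial>m)" using m by simp
  also have "\<dots> = (\<integral>\<^sup>+v. ennreal ((a - y) / (z v - y)) * indicator B (z v) + ennreal ((z v - a) / (z v - y)) * indicator B y \<partial>\<kappa>)"
    by (rule nn_integral_martingale_mixture) simp
  finally have "emeasure m B + (\<integral>\<^sup>+v. ?w v * indicator B y \<partial>\<kappa>)
      = (\<integral>\<^sup>+v. (ennreal ((a - y) / (z v - y)) * indicator B (z v) + ennreal ((z v - a) / (z v - y)) * indicator B y)
          + ?w v * indicator B y \<partial>\<kappa>)"
    by (simp add: nn_integral_add)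
  also have "\<dots> = (\<integral>\<^sup>+v. indicator B y + ?w v * indicator B (z v) \<partial>\<kappa>)"
  proof (rule nn_integral_cong_AE)
    show "AE v in \<kappa>. (ennreal ((a - y) / (z v - y)) * indicator B (z v) + ennreal ((z v - a) / (z v - y)) * indicator B y)
          + ?w v * indicator B y = indicator B y + ?w v * indicator B (z v)"
      using opposite
    proof eventually_elim
      case (elim v)
      have "0 \<le> (a - y) / (z v - y)" using elim by (auto simp: divide_simps)
      then have "\<bar>a - y\<bar> * (1 / \<bar>z v - y\<bar>) = (a - y) / (z v - y)"
        by (simp add: abs_divide[symmetric] del: abs_divide)
      then have w: "?w v = ennreal ((a - y) / (z v - y))" by (simp flip: ennreal_mult')
      have "(z v - a) / (z v - y) + (a - y) / (z v - y) = 1" "0 \<le> (z v - a) / (z v - y)" "0 \<le> (a - y) / (z v - y)"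
        using elim by (auto simp: divide_simps)
      then have "ennreal ((z v - a) / (z v - y)) + ennreal ((a - y) / (z v - y)) = 1"
        by (simp flip: ennreal_plus)
      then show ?case unfolding w by (auto simp: algebra_simps split: split_indicator)
    qed
  qed
  also have "\<dots> = indicator B y + (\<integral>\<^sup>+v. ?w v * indicator B (z v) \<partial>\<kappa>)"
    using \<kappa>.emeasure_space_1 by (subst nn_integral_add) auto
  finally show ?thesis by (simp add: mult.assoc)
qed

end

section \<open>Quantile functions and the measures of the increasing functions \<open>\<Psi>\<^sub>+\<close> and \<open>\<Psi>\<^sub>-\<close>\<close>

lemma quantile_facts:
  assumes "\<mu> \<in> P1"
  shows quantile_measurable: "quantile \<mu> \<in> borel_measurable unit_interval"
    and distr_quantile: "distr unit_interval borel (quantile \<mu>) = \<mu>"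
    and quantile_integrable: "integrable unit_interval (quantile \<mu>)"
    and quantile_mono: "u \<in> {0<..<1} \<Longrightarrow> v \<in> {0<..<1} \<Longrightarrow> u \<le> v \<Longrightarrow> quantile \<mu> u \<le> quantile \<mu> v"
proof -
  interpret cdf_distribution \<mu> unfolding cdf_distribution_def by (rule P1D[OF assms])
  have q: "quantile \<mu> = (\<lambda>u. Inf {x. u \<le> cdf \<mu> x})" by (auto simp: quantile_def)
  show m: "quantile \<mu> \<in> borel_measurable unit_interval"
    unfolding q using measurable_CI by (simp only: measurable_cong_sets[OF sets_unit_interval refl])
  show d: "distr unit_interval borel (quantile \<mu>) = \<mu>"
    unfolding q by (rule distr_I_eq_M)
  show "integrable unit_interval (quantile \<mu>)"
    using integrable_distr[OF m, of "\<lambda>x. x"] P1D(5)[OF assms] unfolding d by simp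
  show "quantile \<mu> u \<le> quantile \<mu> v" if "u \<in> {0<..<1}" "v \<in> {0<..<1}" "u \<le> v"
    unfolding q using mono_I that by (auto simp: mono_on_def)
qed

lemma hoeffding_frechet_in_couplings:
  assumes \<mu>: "\<mu> \<in> P1" and \<nu>: "\<nu> \<in> P1"
  shows "hoeffding_frechet \<mu> \<nu> \<in> couplings \<mu> \<nu>"
proof -
  note quantile_measurable[OF \<mu>, measurable] quantile_measurable[OF \<nu>, measurable]
  let ?T = "\<lambda>u. (quantile \<mu> u, quantile \<nu> u)"
  have T: "?T \<in> unit_interval \<rightarrow>\<^sub>M borel \<Otimes>\<^sub>M borel" by measurable
  have fst: "fst \<in> borel \<Otimes>\<^sub>M borel \<rightarrow>\<^sub>M \<mu>" and snd: "snd \<in> borel \<Otimes>\<^sub>M borel \<rightarrow>\<^sub>M \<nu>"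
    unfolding measurable_cong_sets[OF refl P1D(3)[OF \<mu>]] measurable_cong_sets[OF refl P1D(3)[OF \<nu>]] by simp_all
  have "distr unit_interval \<mu> (quantile \<mu>) = distr unit_interval borel (quantile \<mu>)"
    "distr unit_interval \<nu> (quantile \<nu>) = distr unit_interval borel (quantile \<nu>)"
    using P1D(3)[OF \<mu>] P1D(3)[OF \<nu>] by (auto intro!: distr_cong)
  then have "distr (hoeffding_frechet \<mu> \<nu>) \<mu> fst = \<mu>" "distr (hoeffding_frechet \<mu> \<nu>) \<nu> snd = \<nu>"
    unfolding hoeffding_frechet_def distr_distr[OF fst T] distr_distr[OF snd T]
    by (simp_all add: comp_def distr_quantile \<mu> \<nu>)
  moreover have "sets (\<mu> \<Otimes>\<^sub>M \<nu>) = sets (borel \<Otimes>\<^sub>M (borel :: real measure))"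
    by (rule sets_pair_measure_cong[OF P1D(3)[OF \<mu>] P1D(3)[OF \<nu>]])
  moreover have "prob_space (hoeffding_frechet \<mu> \<nu>)"
    unfolding hoeffding_frechet_def by (rule prob_space.prob_space_distr[OF prob_space_unit_interval T])
  ultimately show ?thesis by (simp add: couplings_def hoeffding_frechet_def)
qed

text \<open>The Stieltjes measure of an indefinite integral has the integrand as its density, because both measures have the same
distribution function.\<close>

lemma interval_measure_indefinite_integral:
  fixes h :: "real \<Rightarrow> real"
  assumes h: "integrable unit_interval h" "\<And>u. 0 \<le> h u"
  shows "restrict_space (interval_measure (\<lambda>u. LBINT v:{0<..<1} \<inter> {..u}. h v)) {0<..<1} =
    density unit_interval (\<lambda>u. ennreal (h u))"
proof -
  define H where "H v = indicator {0<..<1} v * h v" for v :: real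
  have H: "integrable lborel H"
    using h(1) by (simp add: integrable_restrict_space H_def[abs_def])
  have H0: "0 \<le> H v" for v using h(2) by (simp add: H_def)
  have [measurable]: "H \<in> borel_measurable borel" using H by (auto dest: borel_measurable_integrable)
  define m where "m = density lborel (\<lambda>v. ennreal (H v))"
  have mfin: "finite_measure m"
  proof
    have "emeasure m (space m) = (\<integral>\<^sup>+v. ennreal (H v) \<partial>lborel)"
      unfolding m_def by (subst emeasure_density) (auto intro!: nn_integral_cong)
    then show "emeasure m (space m) \<noteq> \<infinity>"
      using H H0 by (simp add: nn_integral_eq_integral)
  qed
  then have fm: "finite_borel_measure m"
    unfolding finite_borel_measure_def finite_borel_measure_axioms_def by (simp add: m_def)
  interpret finite_borel_measure m by fact
  have cdf_m: "cdf m u = (LBINT v:{0<..<1} \<inter> {..u}. h v)" for u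
  proof -
    have "cdf m u = enn2real (\<integral>\<^sup>+v. ennreal (H v * indicator {..u} v) \<partial>lborel)"
      unfolding cdf_def measure_def m_def
      by (subst emeasure_density) (auto intro!: arg_cong[where f=enn2real] nn_integral_cong split: split_indicator)
    also have "\<dots> = (\<integral>v. H v * indicator {..u} v \<partial>lborel)"
      using H0 by (intro integral_eq_nn_integral[symmetric]) auto
    also have "\<dots> = (LBINT v:{0<..<1} \<inter> {..u}. h v)"
      unfolding set_lebesgue_integral_def by (intro Bochner_Integration.integral_cong) (auto simp: H_def split: split_indicator)
    finally show ?thesis .
  qed
  have "interval_measure (cdf m) = m"
  proof (rule cdf_unique'[OF _ fm])
    show "finite_borel_measure (interval_measure (cdf m))"
      by (rule finite_borel_measure_interval_measure[OF cdf_nondecreasing cdf_is_right_cont cdf_lim_at_bot cdf_lim_at_top])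
        auto
    show "cdf (interval_measure (cdf m)) = cdf m"
      by (rule cdf_interval_measure[OF cdf_nondecreasing cdf_is_right_cont cdf_lim_at_bot])
  qed
  then have im: "interval_measure (\<lambda>u. LBINT v:{0<..<1} \<inter> {..u}. h v) = m"
    unfolding cdf_m[symmetric] by simp
  show ?thesis
    unfolding im
  proof (rule measure_eqI)
    show "sets (restrict_space m {0<..<1}) = sets (density unit_interval (\<lambda>u. ennreal (h u)))"
      by (simp add: m_def sets_restrict_space)
    fix A assume "A \<in> sets (restrict_space m {0<..<1})"
    then have A: "A \<in> sets borel" "A \<subseteq> {0<..<1}" "A \<in> sets unit_interval"
      by (auto simp: m_def sets_restrict_space)
    have "emeasure (restrict_space m {0<..<1}) A = emeasure m A"
      using A by (intro emeasure_restrict_space) (auto simp: m_def)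
    also have "\<dots> = (\<integral>\<^sup>+v. ennreal (H v) * indicator A v \<partial>lborel)"
      unfolding m_def using A by (intro emeasure_density) auto
    also have "\<dots> = (\<integral>\<^sup>+v. ennreal (h v) * indicator A v * indicator {0<..<1} v \<partial>lborel)"
      using A by (intro nn_integral_cong) (auto simp: H_def split: split_indicator)
    also have "\<dots> = (\<integral>\<^sup>+v. ennreal (h v) * indicator A v \<partial>unit_interval)"
      by (subst nn_integral_restrict_space) auto
    also have "\<dots> = emeasure (density unit_interval (\<lambda>u. ennreal (h u))) A"
      using A h(1) by (subst emeasure_density) auto
    finally show "emeasure (restrict_space m {0<..<1}) A = \<dots>" .
  qed
qed

lemma scale_density:
  assumes [measurable]: "f \<in> borel_measurable M"
  shows "scale_measure c (density M f) = density M (\<lambda>x. c * f x)"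
proof (rule measure_eqI)
  fix A assume "A \<in> sets (scale_measure c (density M f))"
  then have [measurable]: "A \<in> sets M" by simp
  show "emeasure (scale_measure c (density M f)) A = emeasure (density M (\<lambda>x. c * f x)) A"
    by (simp add: emeasure_density nn_integral_cmult mult.assoc)
qed simp

context
  fixes \<mu> \<nu> :: "real measure"
  assumes \<mu>: "\<mu> \<in> P1" and \<nu>: "\<nu> \<in> P1"
begin

abbreviation (input) "gap u \<equiv> quantile \<mu> u - quantile \<nu> u"

lemma normalized_dPsi_densities:
  "normalized_dPsi_plus \<mu> \<nu> = density unit_interval (\<lambda>u. ennreal (1 / Psi_plus \<mu> \<nu> 1) * ennreal (max 0 (gap u)))"
  "normalized_dPsi_minus \<mu> \<nu> = density unit_interval (\<lambda>u. ennreal (1 / Psi_plus \<mu> \<nu> 1) * ennreal (max 0 (- gap u)))"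
proof -
  have i: "integrable unit_interval (\<lambda>u. max 0 (gap u))" "integrable unit_interval (\<lambda>u. max 0 (- gap u))"
    using quantile_integrable[OF \<mu>] quantile_integrable[OF \<nu>]
    by (auto intro!: integrable_max)
  have P: "Psi_plus \<mu> \<nu> = (\<lambda>u. LBINT v:{0<..<1} \<inter> {..u}. max 0 (gap v))"
    "Psi_minus \<mu> \<nu> = (\<lambda>u. LBINT v:{0<..<1} \<inter> {..u}. max 0 (- gap v))"
    by (auto simp: Psi_plus_def Psi_minus_def)
  have R: "restrict_space (interval_measure (Psi_plus \<mu> \<nu>)) {0<..<1} = density unit_interval (\<lambda>u. ennreal (max 0 (gap u)))"
      "restrict_space (interval_measure (Psi_minus \<mu> \<nu>)) {0<..<1} = density unit_interval (\<lambda>u. ennreal (max 0 (- gap u)))"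
    unfolding P by (rule interval_measure_indefinite_integral; use i in simp)+
  show "normalized_dPsi_plus \<mu> \<nu> = density unit_interval (\<lambda>u. ennreal (1 / Psi_plus \<mu> \<nu> 1) * ennreal (max 0 (gap u)))"
    unfolding normalized_dPsi_plus_def R
    by (rule scale_density) (intro measurable_compose[OF borel_measurable_integrable[OF i(1)] measurable_ennreal])
  show "normalized_dPsi_minus \<mu> \<nu> = density unit_interval (\<lambda>u. ennreal (1 / Psi_plus \<mu> \<nu> 1) * ennreal (max 0 (- gap u)))"
    unfolding normalized_dPsi_minus_def R
    by (rule scale_density) (intro measurable_compose[OF borel_measurable_integrable[OF i(2)] measurable_ennreal])
qed

section \<open>The kernel of \<open>Q\<close> and the associated martingale coupling\<close>

context
  fixes Q \<kappa> m
  assumes Q: "Q \<in> Q_set \<mu> \<nu>" and \<kappa>: "Q_kernel \<mu> \<nu> Q \<kappa>" and m: "martingale_kernel \<mu> \<nu> \<kappa> m"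
begin

lemma gap_measurable[measurable]: "gap \<in> borel_measurable unit_interval"
  using quantile_measurable[OF \<mu>] quantile_measurable[OF \<nu>] by measurable

lemma sets_normalized:
  "sets (normalized_dPsi_plus \<mu> \<nu>) = sets unit_interval" "sets (normalized_dPsi_minus \<mu> \<nu>) = sets unit_interval"
  "space (normalized_dPsi_plus \<mu> \<nu>) = {0<..<1}" "space (normalized_dPsi_minus \<mu> \<nu>) = {0<..<1}"
  unfolding normalized_dPsi_densities by (simp_all add: space_unit_interval)

lemma Q_coupling:
  "prob_space Q" "sets Q = sets (unit_interval \<Otimes>\<^sub>M unit_interval)"
  "distr Q (normalized_dPsi_plus \<mu> \<nu>) fst = normalized_dPsi_plus \<mu> \<nu>"
  "distr Q (normalized_dPsi_minus \<mu> \<nu>) snd = normalized_dPsi_minus \<mu> \<nu>"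
  "fst \<in> Q \<rightarrow>\<^sub>M normalized_dPsi_plus \<mu> \<nu>" "snd \<in> Q \<rightarrow>\<^sub>M normalized_dPsi_minus \<mu> \<nu>"
proof -
  show "prob_space Q"
    "distr Q (normalized_dPsi_plus \<mu> \<nu>) fst = normalized_dPsi_plus \<mu> \<nu>"
    "distr Q (normalized_dPsi_minus \<mu> \<nu>) snd = normalized_dPsi_minus \<mu> \<nu>"
    using Q by (auto simp: Q_set_def couplings_def)
  show s: "sets Q = sets (unit_interval \<Otimes>\<^sub>M unit_interval)"
    using Q sets_pair_measure_cong[OF sets_normalized(1,2)] by (auto simp: Q_set_def couplings_def)
  show "fst \<in> Q \<rightarrow>\<^sub>M normalized_dPsi_plus \<mu> \<nu>" "snd \<in> Q \<rightarrow>\<^sub>M normalized_dPsi_minus \<mu> \<nu>"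
    unfolding measurable_cong_sets[OF s sets_normalized(1)] measurable_cong_sets[OF s sets_normalized(2)]
    by simp_all
qed

text \<open>The first marginal of the probability measure \<open>Q\<close> has total mass 1, which the normalization \<open>1 / \<Psi>\<^sub>+(1)\<close> excludes unless
\<open>\<Psi>\<^sub>+(1) > 0\<close>; recall that division by 0 gives 0.\<close>

lemma Psi_plus_pos: "0 < Psi_plus \<mu> \<nu> 1"
proof (rule ccontr)
  assume "\<not> ?thesis"
  then have c0: "ennreal (1 / Psi_plus \<mu> \<nu> 1) = 0" by (simp add: ennreal_eq_0_iff)
  have "(\<integral>\<^sup>+u. 1 \<partial>normalized_dPsi_plus \<mu> \<nu>) = 0"
    unfolding normalized_dPsi_densities(1) by (subst nn_integral_density) (auto simp: c0)
  then have "emeasure (normalized_dPsi_plus \<mu> \<nu>) (space (normalized_dPsi_plus \<mu> \<nu>)) = 0" by simp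
  moreover have "prob_space (normalized_dPsi_plus \<mu> \<nu>)"
    using prob_space.prob_space_distr[OF Q_coupling(1,5)] unfolding Q_coupling(3) .
  ultimately show False using prob_space.emeasure_space_1 by fastforce
qed

lemma AE_normalized:
  "(AE u in normalized_dPsi_plus \<mu> \<nu>. R u) \<longleftrightarrow> (AE u in unit_interval. 0 < gap u \<longrightarrow> R u)"
  "(AE u in normalized_dPsi_minus \<mu> \<nu>. R u) \<longleftrightarrow> (AE u in unit_interval. gap u < 0 \<longrightarrow> R u)"
  unfolding normalized_dPsi_densities
  by (subst AE_density, measurable, simp add: ennreal_zero_less_mult_iff Psi_plus_pos)+

lemma nn_integral_normalized:
  assumes [measurable]: "g \<in> borel_measurable unit_interval"
  shows "(\<integral>\<^sup>+u. ennreal \<bar>gap u\<bar> * g u \<partial>unit_interval) = ennreal (Psi_plus \<mu> \<nu> 1) *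
    ((\<integral>\<^sup>+u. g u \<partial>normalized_dPsi_plus \<mu> \<nu>) + (\<integral>\<^sup>+u. g u \<partial>normalized_dPsi_minus \<mu> \<nu>))"
proof -
  let ?c = "ennreal (1 / Psi_plus \<mu> \<nu> 1)" and ?P = "ennreal (Psi_plus \<mu> \<nu> 1)"
  have Pc: "?P * ?c = 1" using Psi_plus_pos by (subst ennreal_mult[symmetric]) auto
  have cancel: "?P * (\<integral>\<^sup>+u. g u \<partial>density unit_interval (\<lambda>u. ?c * h u)) = (\<integral>\<^sup>+u. h u * g u \<partial>unit_interval)"
    if [measurable]: "h \<in> borel_measurable unit_interval" for h
  proof -
    have "?P * (\<integral>\<^sup>+u. g u \<partial>density unit_interval (\<lambda>u. ?c * h u)) = ?P * (\<integral>\<^sup>+u. ?c * h u * g u \<partial>unit_interval)"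
      by (subst nn_integral_density) auto
    also have "\<dots> = (\<integral>\<^sup>+u. ?P * (?c * h u * g u) \<partial>unit_interval)"
      by (rule nn_integral_cmult[symmetric]) measurable
    also have "\<dots> = (\<integral>\<^sup>+u. h u * g u \<partial>unit_interval)"
      using Pc by (intro nn_integral_cong) (simp add: mult.assoc[symmetric])
    finally show ?thesis .
  qed
  have "?P * ((\<integral>\<^sup>+u. g u \<partial>normalized_dPsi_plus \<mu> \<nu>) + (\<integral>\<^sup>+u. g u \<partial>normalized_dPsi_minus \<mu> \<nu>))
      = (\<integral>\<^sup>+u. ennreal (max 0 (gap u)) * g u \<partial>unit_interval) + (\<integral>\<^sup>+u. ennreal (max 0 (- gap u)) * g u \<partial>unit_interval)"
    unfolding normalized_dPsi_densities distrib_left by (intro arg_cong2[where f=plus] cancel) measurable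
  also have "\<dots> = (\<integral>\<^sup>+u. ennreal (max 0 (gap u)) * g u + ennreal (max 0 (- gap u)) * g u \<partial>unit_interval)"
    by (rule nn_integral_add[symmetric]) measurable
  also have "\<dots> = (\<integral>\<^sup>+u. ennreal \<bar>gap u\<bar> * g u \<partial>unit_interval)"
    by (intro nn_integral_cong) (auto simp: abs_if max_def ennreal_neg)
  finally show ?thesis ..
qed

lemma kernel_measurable: "\<kappa> \<in> unit_interval \<rightarrow>\<^sub>M prob_algebra unit_interval"
  using \<kappa> unfolding Q_kernel_def disintegrates_def
  by (simp only: measurable_cong_sets[OF sets_normalized(1) refl])

lemma kernelD:
  assumes "u \<in> {0<..<1}"
  shows "prob_space (\<kappa> u)" "sets (\<kappa> u) = sets unit_interval" "space (\<kappa> u) = {0<..<1}"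
  using measurable_space[OF kernel_measurable, of u] assms sets_eq_imp_space_eq[of "\<kappa> u" unit_interval]
  by (auto simp: space_prob_algebra space_unit_interval)

lemma swap_measurable: "(\<lambda>(u, v). (v, u)) \<in> Q \<rightarrow>\<^sub>M unit_interval \<Otimes>\<^sub>M unit_interval"
  unfolding measurable_cong_sets[OF Q_coupling(2) refl] by simp

text \<open>Up to the factor \<open>\<Psi>\<^sub>+(1)\<close>, the measure \<open>\<bar>gap u\<bar> du \<kappa>\<^sub>u(dv)\<close> is the sum of \<open>Q\<close>, from the parameters where the gap is positive, and of the
image of \<open>Q\<close> under the exchange of coordinates, from those where it is negative. In particular it is symmetric.\<close>

lemma nn_integral_kernel_symmetric:
  assumes s[measurable]: "(\<lambda>z. s (fst z) (snd z)) \<in> borel_measurable (unit_interval \<Otimes>\<^sub>M unit_interval)"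
  shows "(\<integral>\<^sup>+u. \<integral>\<^sup>+v. ennreal \<bar>gap u\<bar> * s u v \<partial>\<kappa> u \<partial>unit_interval) =
    ennreal (Psi_plus \<mu> \<nu> 1) * ((\<integral>\<^sup>+z. s (fst z) (snd z) \<partial>Q) + (\<integral>\<^sup>+z. s (snd z) (fst z) \<partial>Q))"
proof -
  have G: "(\<lambda>u. \<integral>\<^sup>+v. s u v \<partial>\<kappa> u) \<in> borel_measurable unit_interval"
    using s by (intro nn_integral_measurable_subprob_algebra2[OF _ measurable_prob_algebraD[OF kernel_measurable]])
      (simp add: case_prod_unfold)
  have "(\<integral>\<^sup>+u. \<integral>\<^sup>+v. ennreal \<bar>gap u\<bar> * s u v \<partial>\<kappa> u \<partial>unit_interval) = (\<integral>\<^sup>+u. ennreal \<bar>gap u\<bar> * (\<integral>\<^sup>+v. s u v \<partial>\<kappa> u) \<partial>unit_interval)"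
  proof (rule nn_integral_cong)
    fix u assume "u \<in> space unit_interval"
    then have u: "u \<in> {0<..<1}" by (simp add: space_unit_interval)
    have "s u \<in> borel_measurable unit_interval"
      using measurable_compose[OF measurable_Pair1'[of u unit_interval unit_interval] s] u by (simp add: space_unit_interval)
    then show "(\<integral>\<^sup>+v. ennreal \<bar>gap u\<bar> * s u v \<partial>\<kappa> u) = ennreal \<bar>gap u\<bar> * (\<integral>\<^sup>+v. s u v \<partial>\<kappa> u)"
      using kernelD[OF u] by (intro nn_integral_cmult) (simp cong: measurable_cong_sets)
  qed
  also have "\<dots> = ennreal (Psi_plus \<mu> \<nu> 1) *
    ((\<integral>\<^sup>+u. \<integral>\<^sup>+v. s u v \<partial>\<kappa> u \<partial>normalized_dPsi_plus \<mu> \<nu>) + (\<integral>\<^sup>+u. \<integral>\<^sup>+v. s u v \<partial>\<kappa> u \<partial>normalized_dPsi_minus \<mu> \<nu>))"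
    by (rule nn_integral_normalized[OF G])
  also have "(\<integral>\<^sup>+u. \<integral>\<^sup>+v. s u v \<partial>\<kappa> u \<partial>normalized_dPsi_plus \<mu> \<nu>) = (\<integral>\<^sup>+z. s (fst z) (snd z) \<partial>Q)"
  proof -
    have d: "disintegrates unit_interval (normalized_dPsi_plus \<mu> \<nu>) Q \<kappa>" using \<kappa> by (simp add: Q_kernel_def)
    have e: "sets (normalized_dPsi_plus \<mu> \<nu> \<Otimes>\<^sub>M unit_interval) = sets (unit_interval \<Otimes>\<^sub>M unit_interval)"
      by (rule sets_pair_measure_cong[OF sets_normalized(1) refl])
    show ?thesis
      using s nn_integral_disintegrates[OF d, of "\<lambda>z. s (fst z) (snd z)"]
      by (simp add: Q_coupling(2) e sets_normalized measurable_cong_sets[OF e refl])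
  qed
  also have "(\<integral>\<^sup>+u. \<integral>\<^sup>+v. s u v \<partial>\<kappa> u \<partial>normalized_dPsi_minus \<mu> \<nu>) = (\<integral>\<^sup>+z. s (snd z) (fst z) \<partial>Q)"
  proof -
    have d: "disintegrates unit_interval (normalized_dPsi_minus \<mu> \<nu>)
        (distr Q (unit_interval \<Otimes>\<^sub>M unit_interval) (\<lambda>(u, v). (v, u))) \<kappa>" using \<kappa> by (simp add: Q_kernel_def)
    have e: "sets (normalized_dPsi_minus \<mu> \<nu> \<Otimes>\<^sub>M unit_interval) = sets (unit_interval \<Otimes>\<^sub>M unit_interval)"
      by (rule sets_pair_measure_cong[OF sets_normalized(2) refl])
    have "(\<integral>\<^sup>+z. s (fst z) (snd z) \<partial>distr Q (unit_interval \<Otimes>\<^sub>M unit_interval) (\<lambda>(u, v). (v, u)))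
        = (\<integral>\<^sup>+z. s (snd z) (fst z) \<partial>Q)"
      using s by (subst nn_integral_distr[OF swap_measurable]) (auto simp: case_prod_unfold)
    then show ?thesis
      using s nn_integral_disintegrates[OF d, of "\<lambda>z. s (fst z) (snd z)"]
      by (simp add: e sets_normalized measurable_cong_sets[OF e refl])
  qed
  finally show ?thesis .
qed

text \<open>If the gap is positive at \<open>u\<close>, then \<open>\<kappa> u\<close> charges only larger parameters \<open>v\<close> with negative gap, so that
\<open>F\<^sub>\<nu>\<^sup>-\<^sup>1(u) < F\<^sub>\<mu>\<^sup>-\<^sup>1(u) \<le> F\<^sub>\<mu>\<^sup>-\<^sup>1(v) < F\<^sub>\<nu>\<^sup>-\<^sup>1(v)\<close>. The case of a negative gap is the mirror image.\<close>

lemma AE_kernel_opposite: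
  "AE u in unit_interval. quantile \<mu> u \<noteq> quantile \<nu> u \<longrightarrow>
    (AE v in \<kappa> u. quantile \<nu> u < quantile \<mu> u \<and> quantile \<mu> u < quantile \<nu> v \<or>
      quantile \<nu> v < quantile \<mu> u \<and> quantile \<mu> u < quantile \<nu> u)"
proof -
  have fst_pos: "AE z in Q. 0 < gap (fst z)"
  proof (rule AE_distrD[OF Q_coupling(5)])
    show "AE u in distr Q (normalized_dPsi_plus \<mu> \<nu>) fst. 0 < gap u"
      unfolding Q_coupling(3) AE_normalized by simp
  qed
  have snd_neg: "AE z in Q. gap (snd z) < 0"
  proof (rule AE_distrD[OF Q_coupling(6)])
    show "AE u in distr Q (normalized_dPsi_minus \<mu> \<nu>) snd. gap u < 0"
      unfolding Q_coupling(4) AE_normalized by simp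
  qed
  have "AE (u, v) in Q. u < v" using Q by (simp add: Q_set_def)
  then have AE_Q: "AE z in Q. fst z < snd z \<and> 0 < gap (fst z) \<and> gap (snd z) < 0"
    using fst_pos snd_neg by eventually_elim auto
  have plus: "AE u in unit_interval. 0 < gap u \<longrightarrow> (AE v in \<kappa> u. u < v \<and> 0 < gap u \<and> gap v < 0)"
  proof -
    have e: "sets (normalized_dPsi_plus \<mu> \<nu> \<Otimes>\<^sub>M unit_interval) = sets (unit_interval \<Otimes>\<^sub>M unit_interval)"
      by (rule sets_pair_measure_cong[OF sets_normalized(1) refl])
    have "AE u in normalized_dPsi_plus \<mu> \<nu>. AE v in \<kappa> u. u < v \<and> 0 < gap u \<and> gap v < 0"
    proof (rule AE_disintegrates)
      show "disintegrates unit_interval (normalized_dPsi_plus \<mu> \<nu>) Q \<kappa>" using \<kappa> by (simp add: Q_kernel_def)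
      show "AE (u, v) in Q. u < v \<and> 0 < gap u \<and> gap v < 0" using AE_Q by (simp add: case_prod_unfold)
    qed (simp_all add: sets_normalized Q_coupling(2) e)
    then show ?thesis unfolding AE_normalized .
  qed
  have minus: "AE v in unit_interval. gap v < 0 \<longrightarrow> (AE u in \<kappa> v. u < v \<and> 0 < gap u \<and> gap v < 0)"
  proof -
    have e: "sets (normalized_dPsi_minus \<mu> \<nu> \<Otimes>\<^sub>M unit_interval) = sets (unit_interval \<Otimes>\<^sub>M unit_interval)"
      by (rule sets_pair_measure_cong[OF sets_normalized(2) refl])
    let ?Q = "distr Q (unit_interval \<Otimes>\<^sub>M unit_interval) (\<lambda>(u, v). (v, u))"
    have "AE v in normalized_dPsi_minus \<mu> \<nu>. AE u in \<kappa> v. u < v \<and> 0 < gap u \<and> gap v < 0"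
    proof (rule AE_disintegrates)
      show "disintegrates unit_interval (normalized_dPsi_minus \<mu> \<nu>) ?Q \<kappa>" using \<kappa> by (simp add: Q_kernel_def)
      note quantile_measurable[OF \<mu>, measurable] quantile_measurable[OF \<nu>, measurable]
      have [measurable]: "(\<lambda>u. u) \<in> borel_measurable unit_interval" by (rule measurable_unit_intervalI) simp
      have "AE z in ?Q. snd z < fst z \<and> 0 < gap (snd z) \<and> gap (fst z) < 0"
        using AE_Q by (subst AE_distr_iff[OF swap_measurable]) (auto simp: case_prod_unfold)
      then show "AE (v, u) in ?Q. u < v \<and> 0 < gap u \<and> gap v < 0" by (simp add: case_prod_unfold)
    qed (simp_all add: sets_normalized e)
    then show ?thesis unfolding AE_normalized .
  qed
  from plus minus AE_space show ?thesis
  proof eventually_elim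
    case (elim u)
    then have u: "u \<in> {0<..<1}" by (simp add: space_unit_interval)
    have sp: "AE v in \<kappa> u. v \<in> {0<..<1}" using AE_space[of "\<kappa> u"] kernelD(3)[OF u] by simp
    show ?case
    proof
      assume "quantile \<mu> u \<noteq> quantile \<nu> u"
      then consider "0 < gap u" | "gap u < 0" by linarith
      then show "AE v in \<kappa> u. quantile \<nu> u < quantile \<mu> u \<and> quantile \<mu> u < quantile \<nu> v \<or>
          quantile \<nu> v < quantile \<mu> u \<and> quantile \<mu> u < quantile \<nu> u"
      proof cases
        case 1
        with elim(1) have "AE v in \<kappa> u. u < v \<and> 0 < gap u \<and> gap v < 0" by simp
        with sp show ?thesis
        proof eventually_elim
          case (elim v)
          then show ?case using quantile_mono[OF \<mu> u, of v] by auto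
        qed
      next
        case 2
        with elim(2) have "AE v in \<kappa> u. v < u \<and> 0 < gap v \<and> gap u < 0" by simp
        with sp show ?thesis
        proof eventually_elim
          case (elim v)
          then show ?case using quantile_mono[OF \<mu> _ u, of v] by auto
        qed
      qed
    qed
  qed
qed

lemma martingale_kernelD:
  "m \<in> unit_interval \<rightarrow>\<^sub>M prob_algebra borel"
  "u \<in> {0<..<1} \<Longrightarrow> prob_space (m u)" "u \<in> {0<..<1} \<Longrightarrow> sets (m u) = sets borel"
  "u \<in> {0<..<1} \<Longrightarrow> quantile \<mu> u = quantile \<nu> u \<Longrightarrow> m u = return borel (quantile \<nu> u)"
proof -
  show *: "m \<in> unit_interval \<rightarrow>\<^sub>M prob_algebra borel" using m by (simp add: martingale_kernel_def)
  show "u \<in> {0<..<1} \<Longrightarrow> prob_space (m u)" "u \<in> {0<..<1} \<Longrightarrow> sets (m u) = sets borel"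
    using borel_kernelD[OF *, of u] by (auto simp: space_unit_interval)
  show "u \<in> {0<..<1} \<Longrightarrow> quantile \<mu> u = quantile \<nu> u \<Longrightarrow> m u = return borel (quantile \<nu> u)"
    using m by (simp add: martingale_kernel_def)
qed

text \<open>The laws \<open>m u\<close> are mixtures of two-point martingale laws with mean \<open>F\<^sub>\<mu>\<^sup>-\<^sup>1(u)\<close> and one atom at \<open>F\<^sub>\<nu>\<^sup>-\<^sup>1(u)\<close>, or point masses when the
gap vanishes; the general results on such mixtures apply with \<open>a = F\<^sub>\<mu>\<^sup>-\<^sup>1(u)\<close>, \<open>y = F\<^sub>\<nu>\<^sup>-\<^sup>1(u)\<close> and \<open>z = F\<^sub>\<nu>\<^sup>-\<^sup>1\<close>.\<close>

lemma AE_martingale_kernel: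
  "AE u in unit_interval. integrable (m u) (\<lambda>z. z) \<and> (\<integral>z. z \<partial>m u) = quantile \<mu> u \<and>
    (\<integral>\<^sup>+z. ennreal \<bar>quantile \<nu> u - z\<bar> \<partial>m u) = ennreal \<bar>gap u\<bar>"
  "B \<in> sets borel \<Longrightarrow> AE u in unit_interval.
    emeasure (m u) B + (\<integral>\<^sup>+v. ennreal \<bar>gap u\<bar> *
      (ennreal (1 / \<bar>quantile \<nu> v - quantile \<nu> u\<bar>) * indicator B (quantile \<nu> u)) \<partial>\<kappa> u)
    = indicator B (quantile \<nu> u) + (\<integral>\<^sup>+v. ennreal \<bar>gap u\<bar> *
      (ennreal (1 / \<bar>quantile \<nu> v - quantile \<nu> u\<bar>) * indicator B (quantile \<nu> v)) \<partial>\<kappa> u)"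
  "AE u in unit_interval. (\<integral>\<^sup>+v. ennreal \<bar>gap u\<bar> * ennreal (1 / \<bar>quantile \<nu> v - quantile \<nu> u\<bar>) \<partial>\<kappa> u) \<le> 1"
proof -
  have formula: "AE u in unit_interval. quantile \<mu> u \<noteq> quantile \<nu> u \<longrightarrow>
      (\<forall>B\<in>sets borel. measure (m u) B =
        (\<integral>v. (quantile \<mu> u - quantile \<nu> u) / (quantile \<nu> v - quantile \<nu> u) * indicator B (quantile \<nu> v)
            + (quantile \<nu> v - quantile \<mu> u) / (quantile \<nu> v - quantile \<nu> u) * indicator B (quantile \<nu> u)
          \<partial>\<kappa> u))"
    using m by (simp add: martingale_kernel_def)
  have \<nu>\<kappa>: "quantile \<nu> \<in> borel_measurable (\<kappa> u)" if "u \<in> {0<..<1}" for u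
    using quantile_measurable[OF \<nu>] by (simp only: measurable_cong_sets[OF kernelD(2)[OF that] refl])
  show "AE u in unit_interval. integrable (m u) (\<lambda>z. z) \<and> (\<integral>z. z \<partial>m u) = quantile \<mu> u \<and>
    (\<integral>\<^sup>+z. ennreal \<bar>quantile \<nu> u - z\<bar> \<partial>m u) = ennreal \<bar>gap u\<bar>"
    using formula AE_kernel_opposite AE_space
  proof eventually_elim
    case (elim u)
    then have u: "u \<in> {0<..<1}" by (simp add: space_unit_interval)
    show ?case
    proof (cases "quantile \<mu> u = quantile \<nu> u")
      case True
      then have "m u = return borel (quantile \<nu> u)" by (rule martingale_kernelD(4)[OF u])
      then show ?thesis using True
        by (auto simp: nn_integral_return integral_return integrable_iff_bounded)
    next
      case False
      note mix = kernelD(1)[OF u] \<nu>\<kappa>[OF u] martingale_kernelD(2,3)[OF u]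
        elim(2)[rule_format, OF False] elim(1)[rule_format, OF False]
      show ?thesis
        using martingale_mixture_mean[OF mix] martingale_mixture_cost[OF mix] by blast
    qed
  qed
  show "AE u in unit_interval.
    emeasure (m u) B + (\<integral>\<^sup>+v. ennreal \<bar>gap u\<bar> *
      (ennreal (1 / \<bar>quantile \<nu> v - quantile \<nu> u\<bar>) * indicator B (quantile \<nu> u)) \<partial>\<kappa> u)
    = indicator B (quantile \<nu> u) + (\<integral>\<^sup>+v. ennreal \<bar>gap u\<bar> *
      (ennreal (1 / \<bar>quantile \<nu> v - quantile \<nu> u\<bar>) * indicator B (quantile \<nu> v)) \<partial>\<kappa> u)"
    if B: "B \<in> sets borel"
    using formula AE_kernel_opposite AE_space
  proof eventually_elim
    case (elim u)
    then have u: "u \<in> {0<..<1}" by (simp add: space_unit_interval)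
    show ?case
    proof (cases "quantile \<mu> u = quantile \<nu> u")
      case True
      then show ?thesis using martingale_kernelD(4)[OF u True] B by simp
    next
      case False
      note mix = kernelD(1)[OF u] \<nu>\<kappa>[OF u] martingale_kernelD(2,3)[OF u]
        elim(2)[rule_format, OF False] elim(1)[rule_format, OF False]
      show ?thesis
        using emeasure_martingale_mixture_balance[OF mix B] by blast
    qed
  qed
  show "AE u in unit_interval. (\<integral>\<^sup>+v. ennreal \<bar>gap u\<bar> * ennreal (1 / \<bar>quantile \<nu> v - quantile \<nu> u\<bar>) \<partial>\<kappa> u) \<le> 1"
    using AE_kernel_opposite AE_space
  proof eventually_elim
    case (elim u)
    then have u: "u \<in> {0<..<1}" by (simp add: space_unit_interval)
    show ?case
    proof (cases "quantile \<mu> u = quantile \<nu> u")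
      case False
      have "AE v in \<kappa> u. ennreal \<bar>gap u\<bar> * ennreal (1 / \<bar>quantile \<nu> v - quantile \<nu> u\<bar>) \<le> 1"
        using elim(1)[rule_format, OF False]
      proof eventually_elim
        case (elim v)
        then have "\<bar>gap u\<bar> * (1 / \<bar>quantile \<nu> v - quantile \<nu> u\<bar>) \<le> 1"
          by (auto simp: abs_if divide_simps)
        then show ?case by (simp add: ennreal_mult'[symmetric])
      qed
      then have "(\<integral>\<^sup>+v. ennreal \<bar>gap u\<bar> * ennreal (1 / \<bar>quantile \<nu> v - quantile \<nu> u\<bar>) \<partial>\<kappa> u) \<le> (\<integral>\<^sup>+v. 1 \<partial>\<kappa> u)"
        by (rule nn_integral_mono_AE)
      then show ?thesis using prob_space.emeasure_space_1[OF kernelD(1)[OF u]] by simp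
    qed simp
  qed
qed

text \<open>This is why the second marginal of the coupling is \<open>\<nu>\<close>. The kernel \<open>m\<close> moves mass from \<open>F\<^sub>\<nu>\<^sup>-\<^sup>1(u)\<close> to \<open>F\<^sub>\<nu>\<^sup>-\<^sup>1(v)\<close> at rate
\<open>\<bar>gap u\<bar> / \<bar>F\<^sub>\<nu>\<^sup>-\<^sup>1(v) - F\<^sub>\<nu>\<^sup>-\<^sup>1(u)\<bar>\<close> for \<open>du \<kappa>\<^sub>u(dv)\<close>. Both \<open>\<bar>gap u\<bar> du \<kappa>\<^sub>u(dv)\<close> and the factor
\<open>1 / \<bar>F\<^sub>\<nu>\<^sup>-\<^sup>1(v) - F\<^sub>\<nu>\<^sup>-\<^sup>1(u)\<bar>\<close> are symmetric in \<open>u\<close> and \<open>v\<close>, so that the gains \<open>?S ?t\<close> equal the losses \<open>?S ?s\<close>. They are at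
most 1 and can be cancelled.\<close>

lemma nn_integral_emeasure_martingale_kernel:
  assumes B[measurable]: "B \<in> sets borel"
  shows "(\<integral>\<^sup>+u. emeasure (m u) B \<partial>unit_interval) = emeasure \<nu> B"
proof -
  interpret I: prob_space unit_interval by (rule prob_space_unit_interval)
  note quantile_measurable[OF \<mu>, measurable] quantile_measurable[OF \<nu>, measurable]
  let ?\<rho> = "\<lambda>u v. ennreal (1 / \<bar>quantile \<nu> v - quantile \<nu> u\<bar>)"
  let ?s = "\<lambda>u v. ?\<rho> u v * indicator B (quantile \<nu> u)" and ?t = "\<lambda>u v. ?\<rho> u v * indicator B (quantile \<nu> v)"
  let ?S = "\<lambda>s. \<integral>\<^sup>+u. \<integral>\<^sup>+v. ennreal \<bar>gap u\<bar> * s u v \<partial>\<kappa> u \<partial>unit_interval"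
  have sm: "(\<lambda>z. ?s (fst z) (snd z)) \<in> borel_measurable (unit_interval \<Otimes>\<^sub>M unit_interval)"
    and tm: "(\<lambda>z. ?t (fst z) (snd z)) \<in> borel_measurable (unit_interval \<Otimes>\<^sub>M unit_interval)" by measurable
  have st: "?S ?s = ?S ?t"
    unfolding nn_integral_kernel_symmetric[OF sm] nn_integral_kernel_symmetric[OF tm]
    by (simp add: abs_minus_commute add.commute)
  have "?S ?s \<le> (\<integral>\<^sup>+u. 1 \<partial>unit_interval)"
  proof (rule nn_integral_mono_AE)
    show "AE u in unit_interval. (\<integral>\<^sup>+v. ennreal \<bar>gap u\<bar> * ?s u v \<partial>\<kappa> u) \<le> 1"
      using AE_martingale_kernel(3)
    proof eventually_elim
      case (elim u)
      have "(\<integral>\<^sup>+v. ennreal \<bar>gap u\<bar> * ?s u v \<partial>\<kappa> u) \<le> (\<integral>\<^sup>+v. ennreal \<bar>gap u\<bar> * ?\<rho> u v \<partial>\<kappa> u)"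
        by (intro nn_integral_mono) (auto split: split_indicator)
      then show ?case using elim by (rule order_trans)
    qed
  qed
  then have fin: "?S ?s \<noteq> \<infinity>" using I.emeasure_space_1 by (auto simp: top_unique)
  have inner: "(\<lambda>u. \<integral>\<^sup>+v. ennreal \<bar>gap u\<bar> * s u v \<partial>\<kappa> u) \<in> borel_measurable unit_interval"
    if "(\<lambda>z. s (fst z) (snd z)) \<in> borel_measurable (unit_interval \<Otimes>\<^sub>M unit_interval)" for s
    using that by (intro nn_integral_measurable_subprob_algebra2[OF _ measurable_prob_algebraD[OF kernel_measurable]])
      (simp add: case_prod_unfold)
  have em: "(\<lambda>u. emeasure (m u) B) \<in> borel_measurable unit_interval"
    by (rule measurable_emeasure_kernel[OF measurable_prob_algebraD[OF martingale_kernelD(1)] B])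
  have "(\<integral>\<^sup>+u. emeasure (m u) B \<partial>unit_interval) + ?S ?s
      = (\<integral>\<^sup>+u. emeasure (m u) B + (\<integral>\<^sup>+v. ennreal \<bar>gap u\<bar> * ?s u v \<partial>\<kappa> u) \<partial>unit_interval)"
    by (rule nn_integral_add[OF em inner[OF sm], symmetric])
  also have "\<dots> = (\<integral>\<^sup>+u. indicator B (quantile \<nu> u) + (\<integral>\<^sup>+v. ennreal \<bar>gap u\<bar> * ?t u v \<partial>\<kappa> u) \<partial>unit_interval)"
    by (rule nn_integral_cong_AE[OF AE_martingale_kernel(2)[OF B]])
  also have "\<dots> = (\<integral>\<^sup>+u. indicator B (quantile \<nu> u) \<partial>unit_interval) + ?S ?t"
    by (rule nn_integral_add[OF _ inner[OF tm]]) measurable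
  also have "(\<integral>\<^sup>+u. indicator B (quantile \<nu> u) \<partial>unit_interval) = (\<integral>\<^sup>+y. indicator B y \<partial>distr unit_interval borel (quantile \<nu>))"
    by (subst nn_integral_distr) auto
  also have "\<dots> = emeasure \<nu> B"
    unfolding distr_quantile[OF \<nu>] using P1D(3)[OF \<nu>] by simp
  finally have "(\<integral>\<^sup>+u. emeasure (m u) B \<partial>unit_interval) + ?S ?s = emeasure \<nu> B + ?S ?s" unfolding st .
  then show ?thesis using fin by (simp only: add.commute[of _ "?S ?s"] ennreal_add_left_cancel) simp
qed

lemma emeasure_M_coupling:
  assumes C: "C \<in> sets (borel \<Otimes>\<^sub>M borel)"
  shows "emeasure (M_coupling \<mu> m) C = (\<integral>\<^sup>+u. emeasure (m u) (Pair (quantile \<mu> u) -` C) \<partial>unit_interval)"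
proof -
  note quantile_measurable[OF \<mu>, measurable] martingale_kernelD(1)[measurable]
  interpret I: prob_space unit_interval by (rule prob_space_unit_interval)
  have J: "(\<lambda>u. return borel (quantile \<mu> u) \<Otimes>\<^sub>M m u) \<in> unit_interval \<rightarrow>\<^sub>M subprob_algebra (borel \<Otimes>\<^sub>M borel)"
    by (rule measurable_prob_algebraD) measurable
  have "emeasure (M_coupling \<mu> m) C = (\<integral>\<^sup>+u. emeasure (return borel (quantile \<mu> u) \<Otimes>\<^sub>M m u) C \<partial>unit_interval)"
    unfolding M_coupling_def by (rule emeasure_bind[OF I.not_empty J C])
  also have "\<dots> = (\<integral>\<^sup>+u. emeasure (m u) (Pair (quantile \<mu> u) -` C) \<partial>unit_interval)"
  proof (rule nn_integral_cong)
    fix u assume "u \<in> space unit_interval"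
    then have u: "u \<in> {0<..<1}" by (simp add: space_unit_interval)
    interpret mu: prob_space "m u" by (rule martingale_kernelD(2)[OF u])
    have mm: "(\<lambda>x. emeasure (m u) (Pair x -` C)) \<in> borel_measurable borel"
      using martingale_kernelD(3)[OF u] C
      by (intro mu.measurable_emeasure_Pair) (simp cong: sets_pair_measure_cong)
    have e: "sets (return borel (quantile \<mu> u) \<Otimes>\<^sub>M m u) = sets (borel \<Otimes>\<^sub>M (borel :: real measure))"
      by (rule sets_pair_measure_cong) (simp_all add: martingale_kernelD(3)[OF u])
    have "emeasure (return borel (quantile \<mu> u) \<Otimes>\<^sub>M m u) C
        = (\<integral>\<^sup>+x. emeasure (m u) (Pair x -` C) \<partial>return borel (quantile \<mu> u))"
      using C e by (intro mu.emeasure_pair_measure_alt) simp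
    also have "\<dots> = emeasure (m u) (Pair (quantile \<mu> u) -` C)"
      using mm by (intro nn_integral_return) auto
    finally show "emeasure (return borel (quantile \<mu> u) \<Otimes>\<^sub>M m u) C = \<dots>" .
  qed
  finally show ?thesis .
qed

lemma M_coupling_in_couplings: "M_coupling \<mu> m \<in> couplings \<mu> \<nu>"
proof -
  note quantile_measurable[OF \<mu>, measurable] martingale_kernelD(1)[measurable]
  interpret I: prob_space unit_interval by (rule prob_space_unit_interval)
  have II: "unit_interval \<in> space (prob_algebra unit_interval)"
    by (simp add: space_prob_algebra I.prob_space_axioms)
  have J: "(\<lambda>u. return borel (quantile \<mu> u) \<Otimes>\<^sub>M m u) \<in> unit_interval \<rightarrow>\<^sub>M prob_algebra (borel \<Otimes>\<^sub>M borel)"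
    by measurable
  have p: "prob_space (M_coupling \<mu> m)" and s: "sets (M_coupling \<mu> m) = sets (borel \<Otimes>\<^sub>M borel)"
    unfolding M_coupling_def using prob_space_bind'[OF II J] sets_bind'[OF II J] by auto
  have sp: "space (M_coupling \<mu> m) = UNIV" using sets_eq_imp_space_eq[OF s] by (simp add: space_pair_measure)
  have f: "fst \<in> M_coupling \<mu> m \<rightarrow>\<^sub>M \<mu>" and g: "snd \<in> M_coupling \<mu> m \<rightarrow>\<^sub>M \<nu>"
    unfolding measurable_cong_sets[OF s P1D(3)[OF \<mu>]] measurable_cong_sets[OF s P1D(3)[OF \<nu>]] by simp_all
  have 1: "distr (M_coupling \<mu> m) \<mu> fst = \<mu>"
  proof (rule measure_eqI)
    fix A assume "A \<in> sets (distr (M_coupling \<mu> m) \<mu> fst)"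
    then have A: "A \<in> sets \<mu>" and A'[measurable]: "A \<in> sets borel" using P1D(3)[OF \<mu>] by auto
    have "emeasure (distr (M_coupling \<mu> m) \<mu> fst) A = emeasure (M_coupling \<mu> m) (A \<times> UNIV)"
      unfolding emeasure_distr[OF f A] sp by (rule arg_cong2[where f=emeasure]) auto
    also have "\<dots> = (\<integral>\<^sup>+u. emeasure (m u) (Pair (quantile \<mu> u) -` (A \<times> UNIV)) \<partial>unit_interval)"
      by (rule emeasure_M_coupling) auto
    also have "\<dots> = (\<integral>\<^sup>+u. indicator A (quantile \<mu> u) \<partial>unit_interval)"
    proof (rule nn_integral_cong)
      fix u assume "u \<in> space unit_interval"
      then have u: "u \<in> {0<..<1}" by (simp add: space_unit_interval)
      have "emeasure (m u) UNIV = 1"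
        using prob_space.emeasure_space_1[OF martingale_kernelD(2)[OF u]] sets_eq_imp_space_eq[OF martingale_kernelD(3)[OF u]] by simp
      then show "emeasure (m u) (Pair (quantile \<mu> u) -` (A \<times> UNIV)) = indicator A (quantile \<mu> u)"
        by (auto split: split_indicator)
    qed
    also have "\<dots> = (\<integral>\<^sup>+x. indicator A x \<partial>distr unit_interval borel (quantile \<mu>))"
      by (subst nn_integral_distr) auto
    also have "\<dots> = emeasure \<mu> A"
      unfolding distr_quantile[OF \<mu>] using A by simp
    finally show "emeasure (distr (M_coupling \<mu> m) \<mu> fst) A = emeasure \<mu> A" .
  qed simp
  have 2: "distr (M_coupling \<mu> m) \<nu> snd = \<nu>"
  proof (rule measure_eqI)
    fix A assume "A \<in> sets (distr (M_coupling \<mu> m) \<nu> snd)"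
    then have A: "A \<in> sets \<nu>" and A'[measurable]: "A \<in> sets borel" using P1D(3)[OF \<nu>] by auto
    have "emeasure (distr (M_coupling \<mu> m) \<nu> snd) A = emeasure (M_coupling \<mu> m) (UNIV \<times> A)"
      unfolding emeasure_distr[OF g A] sp by (rule arg_cong2[where f=emeasure]) auto
    also have "\<dots> = (\<integral>\<^sup>+u. emeasure (m u) (Pair (quantile \<mu> u) -` (UNIV \<times> A)) \<partial>unit_interval)"
      by (rule emeasure_M_coupling) auto
    also have "\<dots> = (\<integral>\<^sup>+u. emeasure (m u) A \<partial>unit_interval)"
      by (intro nn_integral_cong arg_cong2[where f=emeasure]) auto
    also have "\<dots> = emeasure \<nu> A" by (rule nn_integral_emeasure_martingale_kernel[OF A'])
    finally show "emeasure (distr (M_coupling \<mu> m) \<nu> snd) A = emeasure \<nu> A" .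
  qed simp
  have "sets (\<mu> \<Otimes>\<^sub>M \<nu>) = sets (borel \<Otimes>\<^sub>M (borel :: real measure))"
    by (rule sets_pair_measure_cong[OF P1D(3)[OF \<mu>] P1D(3)[OF \<nu>]])
  with p s 1 2 show ?thesis by (simp add: couplings_def)
qed

end

end

section \<open>Optimality of the coupling\<close>

text \<open>Kernels and functions that are only specified on \<open>(0,1)\<close> are continued by a constant, which turns them into Borel
objects on the whole line without changing them almost everywhere.\<close>

lemma measurable_extend_unit_interval:
  assumes "h \<in> unit_interval \<rightarrow>\<^sub>M N" "c \<in> space N"
  shows "(\<lambda>u. if u \<in> {0<..<1} then h u else c) \<in> borel \<rightarrow>\<^sub>M N"
proof -
  have "h \<in> restrict_space borel {u. u \<in> {0<..<1}} \<rightarrow>\<^sub>M N"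
    using assms(1) unfolding measurable_cong_sets[OF sets_unit_interval refl] by (simp only: mem_Collect_eq Collect_mem_eq)
  then show ?thesis
    using assms(2) by (subst measurable_If_restrict_space_iff) auto
qed

theorem proposition3p4:
  fixes \<mu> \<nu> :: "real measure"
  assumes "\<mu> \<in> P1" and "\<nu> \<in> P1"
    and "convex_order_le \<mu> \<nu>" and "\<mu> \<noteq> \<nu>"
    and "\<And>x. (\<forall>u \<in> {Lim (at_left x) (cdf \<mu>)<..cdf \<mu> x} \<inter> {0<..<1}. quantile \<mu> u - quantile \<nu> u \<ge> 0) \<or>
             (\<forall>u \<in> {Lim (at_left x) (cdf \<mu>)<..cdf \<mu> x} \<inter> {0<..<1}. quantile \<mu> u - quantile \<nu> u \<le> 0)"
  shows "\<forall>Q\<in>Q_set \<mu> \<nu>. \<forall>\<kappa> m. Q_kernel \<mu> \<nu> Q \<kappa> \<longrightarrow> martingale_kernel \<mu> \<nu> \<kappa> m \<longrightarrow>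
    martingale_rearrangement_coupling \<mu> \<nu> (hoeffding_frechet \<mu> \<nu>) (M_coupling \<mu> m)"
proof (intro ballI allI impI)
  fix Q \<kappa> m
  assume Q: "Q \<in> Q_set \<mu> \<nu>" and \<kappa>: "Q_kernel \<mu> \<nu> Q \<kappa>" and m: "martingale_kernel \<mu> \<nu> \<kappa> m"
  note \<mu> = assms(1) and \<nu> = assms(2)
  note ctx = \<mu> \<nu> Q \<kappa> m
  define f where "f u = (if u \<in> {0<..<1} then quantile \<mu> u else 0)" for u
  define g where "g u = (if u \<in> {0<..<1} then quantile \<nu> u else 0)" for u
  define K where "K u = (if u \<in> {0<..<1} then m u else return borel 0)" for u
  have f: "f \<in> borel_measurable borel"
    unfolding f_def by (rule measurable_extend_unit_interval[OF quantile_measurable[OF \<mu>]]) simp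
  have g: "g \<in> borel_measurable borel"
    unfolding g_def by (rule measurable_extend_unit_interval[OF quantile_measurable[OF \<nu>]]) simp
  have K: "K \<in> borel \<rightarrow>\<^sub>M prob_algebra borel"
    unfolding K_def
    by (rule measurable_extend_unit_interval[OF martingale_kernelD(1)[OF ctx]])
      (simp add: space_prob_algebra prob_space_return)
  have law_f: "distr unit_interval borel f = \<mu>"
  proof -
    have "distr unit_interval borel f = distr unit_interval borel (quantile \<mu>)"
      by (rule distr_cong) (auto simp: f_def space_unit_interval)
    then show ?thesis by (simp add: distr_quantile[OF \<mu>])
  qed
  obtain U where U: "disintegrates borel \<mu> (parametrized_law f) U"
    using fibre_kernel_exists[OF f law_f] by blast
  let ?\<pi> = "hoeffding_frechet \<mu> \<nu>" and ?M = "M_coupling \<mu> m"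
  have \<pi>_eq: "?\<pi> = distr unit_interval (borel \<Otimes>\<^sub>M borel) (\<lambda>u. (f u, g u))"
    unfolding hoeffding_frechet_def by (rule distr_cong) (auto simp: f_def g_def space_unit_interval)
  have \<pi>: "?\<pi> \<in> couplings \<mu> \<nu>" by (rule hoeffding_frechet_in_couplings[OF \<mu> \<nu>])
  have M: "?M \<in> couplings \<mu> \<nu>" by (rule M_coupling_in_couplings[OF ctx])
  have M_eq: "emeasure ?M C = (\<integral>\<^sup>+u. emeasure (K u) (Pair (f u) -` C) \<partial>unit_interval)"
    if "C \<in> sets (borel \<Otimes>\<^sub>M borel)" for C
    unfolding emeasure_M_coupling[OF ctx that]
    by (rule nn_integral_cong) (simp add: K_def f_def space_unit_interval)
  have kernel: "AE u in unit_interval. integrable (K u) (\<lambda>z. z) \<and> (\<integral>z. z \<partial>K u) = f u \<and>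
      (\<integral>\<^sup>+z. ennreal \<bar>g u - z\<bar> \<partial>K u) = ennreal \<bar>f u - g u\<bar>"
    using AE_martingale_kernel(1)[OF ctx] AE_space
    by eventually_elim (auto simp: K_def f_def g_def space_unit_interval)
  have sign: "AE x in \<mu>. (AE u in U x. g u \<le> f u) \<or> (AE u in U x. f u \<le> g u)"
  proof (rule AE_fibre_constant_sign[OF \<mu> f law_f U])
    show "f u = quantile \<mu> u" if "u \<in> {0<..<1}" for u using that by (simp add: f_def)
    show "(\<forall>u \<in> {Lim (at_left x) (cdf \<mu>)<..cdf \<mu> x} \<inter> {0<..<1}. g u \<le> f u) \<or>
        (\<forall>u \<in> {Lim (at_left x) (cdf \<mu>)<..cdf \<mu> x} \<inter> {0<..<1}. f u \<le> g u)" for x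
      using assms(5)[of x] by (auto simp: f_def g_def)
  qed
  have mart: "?M \<in> martingale_couplings \<mu> \<nu>"
  proof (rule martingale_coupling_from_fibres[OF \<mu> \<nu> f law_f U K M M_eq])
    show "AE u in unit_interval. integrable (K u) (\<lambda>z. z) \<and> (\<integral>z. z \<partial>K u) = f u"
      using kernel by eventually_elim simp
  qed
  let ?b = "\<integral>\<^sup>+x. ennreal \<bar>x - (\<integral>y. y \<partial>disintegration \<mu> ?\<pi> x)\<bar> \<partial>\<mu>"
  have upper: "adapted_wasserstein1 \<mu> ?\<pi> ?M \<le> ?b"
  proof (rule adapted_wasserstein1_le_from_fibres[OF \<mu> \<nu> f law_f g U sign K \<pi> \<pi>_eq M M_eq])
    show "AE u in unit_interval. (\<integral>\<^sup>+z. ennreal \<bar>g u - z\<bar> \<partial>K u) = ennreal \<bar>f u - g u\<bar>"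
      using kernel by eventually_elim simp
  qed
  have lower: "?b \<le> (INF M'\<in>martingale_couplings \<mu> \<nu>. adapted_wasserstein1 \<mu> ?\<pi> M')"
    by (rule INF_greatest) (rule adapted_wasserstein1_ge_barycentre_distance[OF \<mu> \<nu> \<pi>])
  have "adapted_wasserstein1 \<mu> ?\<pi> ?M = (INF M'\<in>martingale_couplings \<mu> \<nu>. adapted_wasserstein1 \<mu> ?\<pi> M')"
    using order_trans[OF upper lower] INF_lower[OF mart] by (rule antisym)
  with mart show "martingale_rearrangement_coupling \<mu> \<nu> ?\<pi> ?M"
    by (simp add: martingale_rearrangement_coupling_def)
qed

end
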